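(* Let $\Gamma$ be a proper NEC group with signature $(g;\pm;[m_1,\ldots,m_r];\{(n_{11},\ldots,n_{1s_1}),\ldots,(n_{k1},\ldots,n_{ks_k})\})$. Then $\Gamma$ has a torsion-free normal subgroup of finite index consisting of orientation-preserving elements.
   Context: $\mathcal{H}$ is the hyperbolic plane. An NEC (non-Euclidean crystallographic) group is a discrete subgroup $\Gamma$ of the group $\mathrm{Isom}^{\pm}(\mathcal{H})$ of all isometries of $\mathcal{H}$ (orientation-preserving or orientation-reversing) such that the orbit space $\mathcal{H}/\Gamma$ is compact. It is proper if it contains an element reversing the orientation of $\mathcal{H}$, i.e. it is not a Fuchsian group. "Torsion-free" means having no non-identity element of finite order. Every NEC group has a signature $(g;\pm;[m_1,\ldots,m_r];\{(n_{11},\ldots,n_{1s_1}),\ldots,(n_{k1},\ldots,n_{ks_k})\})$ with all $m_i,n_{ij}\ge 2$, which encodes a presentation with generators $x_i$ ($1\le i\le r$), $e_i$ ($1\le i\le k$), $c_{ij}$ ($1\le i\le k$, $0\le j\le s_i$), and $a_i,b_i$ ($1\le i\le g$) if the sign is $+$, or $d_i$ ($1\le i\le g$) if the sign is $-$, subject to the defining relations $x_i^{m_i}=1$; $c_{i,j-1}^2=c_{ij}^2=(c_{i,j-1}c_{ij})^{n_{ij}}=1$ for $1\le j\le s_i$ (and $c_{i0}^2=1$ if $s_i=0$); $c_{is_i}=e_ic_{i0}e_i^{-1}$; and $[a_1,b_1]\cdots[a_g,b_g]x_1\cdots x_re_1\cdots e_k=1$ (sign $+$) or $d_1^2\cdots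 d_g^2x_1\cdots x_re_1\cdots e_k=1$ (sign $-$). Here the $x_i$ are elliptic, the $c_{ij}$ are reflections, the $e_i,a_i,b_i$ preserve orientation, and the $d_i$ are glide reflections (reversing orientation). *)

theory Defs
  imports "HOL-Analysis.Analysis" "HOL-Algebra.Group_Action"
begin

section \<open>The hyperbolic plane\<close>

definition upper_half_plane :: "complex set" where
  "upper_half_plane = {z. Im z > 0}"

text \<open>
  The metric of curvature -1: sinh (d / 2) = |z - w| / (2 sqrt (Im z Im w)).
  The absolute values under the root are irrelevant on the upper half-plane; they are there because
  the locale \<open>Metric_space\<close> asks for a distance that is nonnegative on the whole type.
\<close>

definition hdist :: "complex \<Rightarrow> complex \<Rightarrow> real" where
  "hdist z w = 2 * arsinh (cmod (z - w) / (2 * sqrt (\<bar>Im z\<bar> * \<bar>Im w\<bar>)))"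

lemma cosh_half_hdist:
  assumes "Im z > 0" "Im w > 0"
  shows "cosh (hdist z w / 2) = cmod (z - cnj w) / (2 * sqrt (Im z * Im w))"
proof -
  let ?p = "Im z * Im w"
  have p: "?p > 0" using assms by simp
  have "cosh (hdist z w / 2) ^ 2 = 1 + (cmod (z - w) / (2 * sqrt ?p)) ^ 2"
    using assms by (simp add: hdist_def cosh_square_eq)
  also have "\<dots> = (4 * ?p + (cmod (z - w))\<^sup>2) / (4 * ?p)"
    using p assms by (simp add: power_divide power_mult_distrib add_divide_distrib)
  also have "4 * ?p + (cmod (z - w))\<^sup>2 = (cmod (z - cnj w))\<^sup>2"
    by (simp only: cmod_power2) (simp add: power2_eq_square algebra_simps)
  also have "(cmod (z - cnj w))\<^sup>2 / (4 * ?p) = (cmod (z - cnj w) / (2 * sqrt ?p))\<^sup>2"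
    using p by (simp add: power_divide power_mult_distrib)
  finally show ?thesis
    by (rule power2_eq_imp_eq) (use p in \<open>simp_all add: order.strict_implies_order\<close>)
qed

lemma hdist_triangle:
  assumes "Im z > 0" "Im v > 0" "Im w > 0"
  shows "hdist z w \<le> hdist z v + hdist v w"
proof -
  define a b c where "a = hdist z v / 2" and "b = hdist v w / 2" and "c = hdist z w / 2"
  define p where "p = sqrt (Im z) * sqrt (Im w)"
  have p: "p > 0" using assms by (simp add: p_def)
  have sv: "sqrt (Im v) * sqrt (Im v) = Im v" using assms by simp
  have sa: "sinh a = cmod (z - v) / (2 * (sqrt (Im z) * sqrt (Im v)))"
    and sb: "sinh b = cmod (v - w) / (2 * (sqrt (Im v) * sqrt (Im w)))"
    and sc: "sinh c = cmod (z - w) / (2 * p)"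
    using assms by (simp_all add: a_def b_def c_def p_def hdist_def real_sqrt_mult)
  have ca: "cosh a = cmod (z - cnj v) / (2 * (sqrt (Im z) * sqrt (Im v)))"
    using cosh_half_hdist[of z v] assms by (simp add: a_def real_sqrt_mult)
  have "cosh b = cmod (v - cnj w) / (2 * (sqrt (Im v) * sqrt (Im w)))"
    using cosh_half_hdist[of v w] assms by (simp add: b_def real_sqrt_mult)
  also have "cmod (v - cnj w) = cmod (w - cnj v)"
    by (metis complex_cnj_cnj complex_cnj_diff complex_mod_cnj norm_minus_commute)
  finally have cb: "cosh b = cmod (w - cnj v) / (2 * (sqrt (Im v) * sqrt (Im w)))" .
  have "(z - w) * (v - cnj v) = (z - v) * (w - cnj v) + (z - cnj v) * (v - w)"
    by (simp add: algebra_simps)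
  then have "cmod (z - w) * cmod (v - cnj v)
      \<le> cmod (z - v) * cmod (w - cnj v) + cmod (z - cnj v) * cmod (v - w)"
    by (metis norm_mult norm_triangle_ineq)
  moreover have "cmod (v - cnj v) = 2 * Im v"
    using assms by (simp add: complex_diff_cnj norm_mult)
  ultimately have pt: "cmod (z - w) * (2 * Im v)
      \<le> cmod (z - v) * cmod (w - cnj v) + cmod (z - cnj v) * cmod (v - w)" by simp
  have "sinh c = cmod (z - w) * (2 * Im v) / (4 * p * Im v)"
    using assms p by (simp add: sc field_simps)
  also have "\<dots> \<le> (cmod (z - v) * cmod (w - cnj v) + cmod (z - cnj v) * cmod (v - w)) / (4 * p * Im v)"
    using pt p assms by (intro divide_right_mono) auto
  also have "4 * p * Im v
      = (2 * (sqrt (Im z) * sqrt (Im v))) * (2 * (sqrt (Im v) * sqrt (Im w)))"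
    by (subst sv[symmetric]) (simp add: p_def algebra_simps)
  also have "(cmod (z - v) * cmod (w - cnj v) + cmod (z - cnj v) * cmod (v - w)) / \<dots>
      = sinh (a + b)"
    unfolding sinh_add sa sb ca cb by (simp add: add_divide_distrib)
  finally have "c \<le> a + b" by simp
  then show ?thesis by (simp add: a_def b_def c_def)
qed

interpretation hyp: Metric_space upper_half_plane hdist
proof
  show "0 \<le> hdist x y" for x y
  proof -
    have "0 \<le> cmod (x - y) / (2 * sqrt (\<bar>Im x\<bar> * \<bar>Im y\<bar>))" by simp
    then have "\<not> arsinh (cmod (x - y) / (2 * sqrt (\<bar>Im x\<bar> * \<bar>Im y\<bar>))) < 0"
      unfolding arsinh_real_neg_iff by (rule leD)
    then show ?thesis unfolding hdist_def by linarith
  qed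
  show "hdist x y = hdist y x" for x y
    by (simp add: hdist_def norm_minus_commute mult.commute)
  show "hdist x y = 0 \<longleftrightarrow> x = y" if "x \<in> upper_half_plane" "y \<in> upper_half_plane" for x y
    using that by (simp add: hdist_def upper_half_plane_def)
  show "hdist x z \<le> hdist x y + hdist y z"
    if "x \<in> upper_half_plane" "y \<in> upper_half_plane" "z \<in> upper_half_plane" for x y z
    using that hdist_triangle by (simp add: upper_half_plane_def)
qed


section \<open>Isometries\<close>

definition hyp_isometries :: "(complex \<Rightarrow> complex) set" where
  "hyp_isometries = {f \<in> Bij upper_half_plane.
     \<forall>z\<in>upper_half_plane. \<forall>w\<in>upper_half_plane. hdist (f z) (f w) = hdist z w}"

definition isom_group :: "(complex \<Rightarrow> complex) monoid" where
  "isom_group = (BijGroup upper_half_plane)\<lparr>carrier := hyp_isometries\<rparr>"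

lemma subgroup_hyp_isometries: "subgroup hyp_isometries (BijGroup upper_half_plane)"
proof -
  let ?H = upper_half_plane
  interpret B: group "BijGroup ?H" by (rule group_BijGroup)
  have map: "f z \<in> ?H" if "f \<in> Bij ?H" "z \<in> ?H" for f z
    using that Bij_imp_funcset by blast
  show ?thesis
  proof (rule B.subgroupI)
    show "hyp_isometries \<subseteq> carrier (BijGroup ?H)"
      by (auto simp: hyp_isometries_def BijGroup_def)
    have "(\<lambda>x\<in>?H. x) \<in> hyp_isometries"
      by (simp add: hyp_isometries_def id_Bij)
    then show "hyp_isometries \<noteq> {}" by blast
  next
    fix f assume f: "f \<in> hyp_isometries"
    then have fB: "f \<in> Bij ?H" by (simp add: hyp_isometries_def)
    let ?i = "\<lambda>x\<in>?H. inv_into ?H f x"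
    have i: "?i z \<in> ?H" "f (?i z) = z" if "z \<in> ?H" for z
      using fB that by (auto simp: Bij_def bij_betw_def f_inv_into_f inv_into_into)
    have "hdist (?i z) (?i w) = hdist z w" if "z \<in> ?H" "w \<in> ?H" for z w
      using f i[OF that(1)] i[OF that(2)] unfolding hyp_isometries_def by fastforce
    then have "?i \<in> hyp_isometries"
      using restrict_inv_into_Bij[OF fB] unfolding hyp_isometries_def by blast
    then show "inv\<^bsub>BijGroup ?H\<^esub> f \<in> hyp_isometries"
      using inv_BijGroup[OF fB] by simp
  next
    fix f g assume "f \<in> hyp_isometries" "g \<in> hyp_isometries"
    then show "f \<otimes>\<^bsub>BijGroup ?H\<^esub> g \<in> hyp_isometries"
      by (auto simp: hyp_isometries_def BijGroup_def compose_Bij compose_eq map)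
  qed
qed

lemma group_isom_group: "group isom_group"
  unfolding isom_group_def
  by (rule group.subgroup_imp_group[OF group_BijGroup subgroup_hyp_isometries])

text \<open>The compact-open topology on the group of isometries.\<close>

definition isom_topology :: "(complex \<Rightarrow> complex) topology" where
  "isom_topology = topology_generated_by
     {{f \<in> hyp_isometries. f ` K \<subseteq> U} | K U. compactin hyp.mtopology K \<and> openin hyp.mtopology U}"

definition jacobian_det :: "(complex \<Rightarrow> complex) \<Rightarrow> real" where
  "jacobian_det D = Re (D 1) * Im (D \<i>) - Re (D \<i>) * Im (D 1)"

definition orientation_preserving :: "(complex \<Rightarrow> complex) \<Rightarrow> bool" where
  "orientation_preserving f \<longleftrightarrow>
     (\<forall>z\<in>upper_half_plane. \<exists>D. (f has_derivative D) (at z) \<and> jacobian_det D > 0)"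

definition orientation_reversing :: "(complex \<Rightarrow> complex) \<Rightarrow> bool" where
  "orientation_reversing f \<longleftrightarrow>
     (\<forall>z\<in>upper_half_plane. \<exists>D. (f has_derivative D) (at z) \<and> jacobian_det D < 0)"

text \<open>Geodesic lines, parametrized by arc length.\<close>

definition geodesic_line :: "(real \<Rightarrow> complex) \<Rightarrow> bool" where
  "geodesic_line \<gamma> \<longleftrightarrow>
     range \<gamma> \<subseteq> upper_half_plane \<and> (\<forall>s t. hdist (\<gamma> s) (\<gamma> t) = \<bar>s - t\<bar>)"

definition elliptic :: "(complex \<Rightarrow> complex) \<Rightarrow> bool" where
  "elliptic f \<longleftrightarrow> f \<in> hyp_isometries \<and> orientation_preserving f \<and> f \<noteq> \<one>\<^bsub>isom_group\<^esub> \<and>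
     (\<exists>z\<in>upper_half_plane. f z = z)"

definition reflection :: "(complex \<Rightarrow> complex) \<Rightarrow> bool" where
  "reflection f \<longleftrightarrow> f \<in> hyp_isometries \<and> orientation_reversing f \<and>
     (\<exists>\<gamma>. geodesic_line \<gamma> \<and> (\<forall>t. f (\<gamma> t) = \<gamma> t))"

definition glide_reflection :: "(complex \<Rightarrow> complex) \<Rightarrow> bool" where
  "glide_reflection f \<longleftrightarrow> f \<in> hyp_isometries \<and> orientation_reversing f \<and>
     (\<exists>\<gamma> l. geodesic_line \<gamma> \<and> l \<noteq> 0 \<and> (\<forall>t. f (\<gamma> t) = \<gamma> (t + l)))"


section \<open>NEC groups\<close>

abbreviation isom_subgroup :: "(complex \<Rightarrow> complex) set \<Rightarrow> (complex \<Rightarrow> complex) monoid" where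
  "isom_subgroup \<Gamma> \<equiv> isom_group\<lparr>carrier := \<Gamma>\<rparr>"

text \<open>The orbit space, with the quotient topology: a set of orbits is open iff its union is.\<close>

definition orbit_space :: "(complex \<Rightarrow> complex) set \<Rightarrow> complex set topology" where
  "orbit_space \<Gamma> = topology (\<lambda>\<U>. \<U> \<subseteq> orbits (isom_subgroup \<Gamma>) upper_half_plane (\<lambda>f. f) \<and>
     openin hyp.mtopology (\<Union>\<U>))"

definition NEC_group :: "(complex \<Rightarrow> complex) set \<Rightarrow> bool" where
  "NEC_group \<Gamma> \<longleftrightarrow> subgroup \<Gamma> isom_group \<and>
     subtopology isom_topology \<Gamma> = discrete_topology \<Gamma> \<and>
     compact_space (orbit_space \<Gamma>)"

definition proper_NEC_group :: "(complex \<Rightarrow> complex) set \<Rightarrow> bool" where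
  "proper_NEC_group \<Gamma> \<longleftrightarrow> NEC_group \<Gamma> \<and> (\<exists>f\<in>\<Gamma>. orientation_reversing f)"

definition torsion_free :: "('a, 'b) monoid_scheme \<Rightarrow> bool" where
  "torsion_free G \<longleftrightarrow>
     (\<forall>x\<in>carrier G. \<forall>n::nat. n > 0 \<longrightarrow> x [^]\<^bsub>G\<^esub> n = \<one>\<^bsub>G\<^esub> \<longrightarrow> x = \<one>\<^bsub>G\<^esub>)"

lemma orbits_disjoint:
  assumes \<Gamma>: "subgroup \<Gamma> isom_group"
    and A: "A \<in> orbits (isom_subgroup \<Gamma>) upper_half_plane (\<lambda>f. f)"
    and B: "B \<in> orbits (isom_subgroup \<Gamma>) upper_half_plane (\<lambda>f. f)"
    and "x \<in> A" "x \<in> B"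
  shows "A = B"
proof -
  let ?H = upper_half_plane and ?G = "isom_subgroup \<Gamma>"
  interpret I: group isom_group by (rule group_isom_group)
  interpret S: subgroup \<Gamma> isom_group by (rule \<Gamma>)
  have "subgroup \<Gamma> (BijGroup ?H)"
    using group.incl_subgroup[OF group_BijGroup subgroup_hyp_isometries] \<Gamma>
    by (simp add: isom_group_def)
  then have "group_hom ?G (BijGroup ?H) (\<lambda>f. f)"
    using group_BijGroup I.subgroup_imp_group[OF \<Gamma>]
    by (auto simp: group_hom_def group_hom_axioms_def hom_def isom_group_def
        dest: subgroup.mem_carrier)
  then have "group_action ?G ?H (\<lambda>f. f)" by (simp add: group_action_def)
  then interpret group_action ?G ?H "\<lambda>f. f" .
  show ?thesis
    using disjoint_union[OF A B] assms(4,5) by blast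
qed

lemma openin_orbit_space:
  assumes "subgroup \<Gamma> isom_group"
  shows "openin (orbit_space \<Gamma>) \<U> \<longleftrightarrow>
    \<U> \<subseteq> orbits (isom_subgroup \<Gamma>) upper_half_plane (\<lambda>f. f) \<and> openin hyp.mtopology (\<Union>\<U>)"
proof -
  let ?O = "orbits (isom_subgroup \<Gamma>) upper_half_plane (\<lambda>f. f)"
  have "istopology (\<lambda>\<U>. \<U> \<subseteq> ?O \<and> openin hyp.mtopology (\<Union>\<U>))"
    unfolding istopology_def
  proof (intro conjI allI impI)
    fix S T assume S: "S \<subseteq> ?O \<and> openin hyp.mtopology (\<Union>S)"
      and T: "T \<subseteq> ?O \<and> openin hyp.mtopology (\<Union>T)"
    have "\<Union>(S \<inter> T) = \<Union>S \<inter> \<Union>T"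
      using S T orbits_disjoint[OF assms] by blast
    then show "openin hyp.mtopology (\<Union>(S \<inter> T))" using S T by auto
    show "S \<inter> T \<subseteq> ?O" using S by blast
  next
    fix \<K> assume K: "\<forall>K\<in>\<K>. K \<subseteq> ?O \<and> openin hyp.mtopology (\<Union>K)"
    then have "openin hyp.mtopology (\<Union>(Union ` \<K>))"
      by (intro openin_Union) auto
    moreover have "\<Union>(Union ` \<K>) = \<Union>(\<Union>\<K>)" by blast
    ultimately show "openin hyp.mtopology (\<Union>(\<Union>\<K>))" by simp
    show "\<Union>\<K> \<subseteq> ?O" using K by blast
  qed
  then show ?thesis by (simp add: orbit_space_def)
qed


section \<open>Group presentations\<close>

text \<open>
  A letter \<open>(s, True)\<close> stands for the generator \<open>s\<close>, and \<open>(s, False)\<close> for its formal inverse.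
\<close>

type_synonym 'a word = "('a \<times> bool) list"

definition words :: "'a set \<Rightarrow> 'a word set" where
  "words S = lists (S \<times> UNIV)"

text \<open>
  A relation \<open>l = r\<close> is a pair of words. The relation below is the congruence on words generated
  by free cancellation and the given relations, so its classes form the presented group.
\<close>

inductive word_cong :: "'a set \<Rightarrow> ('a word \<times> 'a word) set \<Rightarrow> 'a word \<Rightarrow> 'a word \<Rightarrow> bool"
  for S R where
  refl: "w \<in> words S \<Longrightarrow> word_cong S R w w"
| sym: "word_cong S R v w \<Longrightarrow> word_cong S R w v"
| trans: "word_cong S R u v \<Longrightarrow> word_cong S R v w \<Longrightarrow> word_cong S R u w"
| cancel: "u \<in> words S \<Longrightarrow> v \<in> words S \<Longrightarrow> s \<in> S \<Longrightarrow>
    word_cong S R (u @ [(s, b), (s, \<not> b)] @ v) (u @ v)"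
| relation: "u \<in> words S \<Longrightarrow> v \<in> words S \<Longrightarrow> (l, r) \<in> R \<Longrightarrow>
    word_cong S R (u @ l @ v) (u @ r @ v)"

definition word_value :: "('g, 'b) monoid_scheme \<Rightarrow> ('a \<Rightarrow> 'g) \<Rightarrow> 'a word \<Rightarrow> 'g" where
  "word_value G \<phi> w =
     foldr (\<lambda>(s, b) x. (if b then \<phi> s else inv\<^bsub>G\<^esub> \<phi> s) \<otimes>\<^bsub>G\<^esub> x) w \<one>\<^bsub>G\<^esub>"

definition presents ::
  "'a set \<Rightarrow> ('a word \<times> 'a word) set \<Rightarrow> ('a \<Rightarrow> 'g) \<Rightarrow> ('g, 'b) monoid_scheme \<Rightarrow> bool" where
  "presents S R \<phi> G \<longleftrightarrow>
     \<phi> \<in> S \<rightarrow> carrier G \<and>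
     carrier G \<subseteq> word_value G \<phi> ` words S \<and>
     (\<forall>v\<in>words S. \<forall>w\<in>words S. word_value G \<phi> v = word_value G \<phi> w \<longleftrightarrow> word_cong S R v w)"


section \<open>Signatures\<close>

text \<open>
  All indices are shifted to start from 0, except for the second index of \<open>c_gen\<close>, which already
  starts from 0: the classical generators x_{i+1}, e_{i+1}, c_{i+1,j}, a_{i+1}, b_{i+1}, d_{i+1}
  are \<open>x_gen i\<close>, \<open>e_gen i\<close>, \<open>c_gen i j\<close>, \<open>a_gen i\<close>, \<open>b_gen i\<close>, \<open>d_gen i\<close>. A period cycle may be empty.
\<close>

datatype nec_sign = Plus | Minus

datatype nec_generator = x_gen nat | e_gen nat | c_gen nat nat | a_gen nat | b_gen nat | d_gen nat

definition nec_generators ::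
  "nat \<Rightarrow> nec_sign \<Rightarrow> nat list \<Rightarrow> nat list list \<Rightarrow> nec_generator set" where
  "nec_generators g \<epsilon> ms nss =
     {x_gen i | i. i < length ms} \<union>
     {e_gen i | i. i < length nss} \<union>
     {c_gen i j | i j. i < length nss \<and> j \<le> length (nss ! i)} \<union>
     (case \<epsilon> of Plus \<Rightarrow> {a_gen i | i. i < g} \<union> {b_gen i | i. i < g} | Minus \<Rightarrow> {d_gen i | i. i < g})"

abbreviation letter :: "'a \<Rightarrow> 'a \<times> bool" where "letter s \<equiv> (s, True)"

abbreviation inv_letter :: "'a \<Rightarrow> 'a \<times> bool" where "inv_letter s \<equiv> (s, False)"

abbreviation word_power :: "'a word \<Rightarrow> nat \<Rightarrow> 'a word" where
  "word_power w n \<equiv> concat (replicate n w)"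

definition surface_word :: "nat \<Rightarrow> nec_sign \<Rightarrow> nec_generator word" where
  "surface_word g \<epsilon> = (case \<epsilon> of
     Plus \<Rightarrow> concat (map (\<lambda>i. [letter (a_gen i), letter (b_gen i),
       inv_letter (a_gen i), inv_letter (b_gen i)]) [0..<g])
   | Minus \<Rightarrow> concat (map (\<lambda>i. [letter (d_gen i), letter (d_gen i)]) [0..<g]))"

definition nec_relations ::
  "nat \<Rightarrow> nec_sign \<Rightarrow> nat list \<Rightarrow> nat list list \<Rightarrow> (nec_generator word \<times> nec_generator word) set"
where
  "nec_relations g \<epsilon> ms nss =
     {(word_power [letter (x_gen i)] (ms ! i), []) | i. i < length ms} \<union>
     {(word_power [letter (c_gen i j)] 2, []) | i j. i < length nss \<and> j \<le> length (nss ! i)} \<union>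
     {(word_power [letter (c_gen i j), letter (c_gen i (Suc j))] (nss ! i ! j), []) | i j.
        i < length nss \<and> j < length (nss ! i)} \<union>
     {([letter (c_gen i (length (nss ! i)))],
        [letter (e_gen i), letter (c_gen i 0), inv_letter (e_gen i)]) | i.
        i < length nss} \<union>
     {(surface_word g \<epsilon> @ map (\<lambda>i. letter (x_gen i)) [0..<length ms] @
         map (\<lambda>i. letter (e_gen i)) [0..<length nss], [])}"

definition has_signature ::
  "(complex \<Rightarrow> complex) set \<Rightarrow> nat \<Rightarrow> nec_sign \<Rightarrow> nat list \<Rightarrow> nat list list \<Rightarrow> bool" where
  "has_signature \<Gamma> g \<epsilon> ms nss \<longleftrightarrow>
     (\<forall>m\<in>set ms. m \<ge> 2) \<and> (\<forall>ns\<in>set nss. \<forall>n\<in>set ns. n \<ge> 2) \<and>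
     (\<exists>\<phi>. presents (nec_generators g \<epsilon> ms nss) (nec_relations g \<epsilon> ms nss) \<phi> (isom_subgroup \<Gamma>) \<and>
       (\<forall>i<length ms. elliptic (\<phi> (x_gen i))) \<and>
       (\<forall>i<length nss. orientation_preserving (\<phi> (e_gen i))) \<and>
       (\<forall>i<length nss. \<forall>j\<le>length (nss ! i). reflection (\<phi> (c_gen i j))) \<and>
       (case \<epsilon> of
          Plus \<Rightarrow> \<forall>i<g. orientation_preserving (\<phi> (a_gen i)) \<and> orientation_preserving (\<phi> (b_gen i))
        | Minus \<Rightarrow> \<forall>i<g. glide_reflection (\<phi> (d_gen i))))"

end

theory Submission
  imports Defs "HOL-Computational_Algebra.Polynomial"
begin

text \<open>
  In the hyperboloid model an isometry of the plane is the restriction of a linear map of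
  \<open>\<real>\<^sup>3\<close>, so \<open>\<Gamma>\<close> is a finitely generated linear group, with all matrix entries in a finitely
  generated subring A of the reals. A non-identity element of finite order has a fixed point
  (normalize the sum of an orbit), and by cocompactness a conjugate of it moves i by a bounded
  amount; by discreteness there are only finitely many such conjugates. As in Malcev's theorem, A
  has an ideal I of finite index that contains none of the finitely many nonzero entries of their
  differences from the identity matrix. The orientation-preserving elements of \<open>\<Gamma>\<close> that are
  congruent to the identity modulo I form the required subgroup.
\<close>

section \<open>Finite quotients of finitely generated domains\<close>

text \<open>The ideal I comes from a property stronger than residual finiteness: every nonzero
  element of A is a unit modulo some proper ideal of finite index. This form survives the adjunction
  of one element x. Applied to the leading coefficient of a polynomial p, it makes p monic up to a
  unit modulo I, so that A[X] modulo I and p is a finite nonzero ring. For x algebraic, p has least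
  degree among the polynomials vanishing at x; for x transcendental, p can be chosen freely.
  Finitely many nonzero elements are kept out of I at once by inverting their product. The torsion
  elements of \<open>\<Gamma>\<close> may be infinitely many. The congruence condition needs to
  exclude only finitely many of them because the subgroup is normal: with a torsion element it would
  contain the conjugate of small displacement. Discreteness is given in the compact-open topology
  and compactness in the quotient topology, so both are first turned into statements about
  distances. The signature supplies the finite generating set and the orientation of each
  generator.\<close>

definition subring_set :: "'a::comm_ring_1 set \<Rightarrow> bool" where
  "subring_set A \<longleftrightarrow> 1 \<in> A \<and> (\<forall>x\<in>A. \<forall>y\<in>A. x - y \<in> A \<and> x * y \<in> A)"

text \<open>The quotient ring is never formed: \<open>F\<close> meets every residue class, and
  \<open>1 \<notin> I\<close> excludes the zero ring.\<close>

definition finite_quotient :: "'a::comm_ring_1 set \<Rightarrow> 'a set \<Rightarrow> bool" where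
  "finite_quotient A I \<longleftrightarrow> I \<subseteq> A \<and> 0 \<in> I \<and> 1 \<notin> I \<and>
     (\<forall>x\<in>I. \<forall>y\<in>I. x - y \<in> I) \<and> (\<forall>a\<in>A. \<forall>x\<in>I. a * x \<in> I) \<and>
     (\<exists>F. finite F \<and> F \<subseteq> A \<and> (\<forall>x\<in>A. \<exists>y\<in>F. x - y \<in> I))"

definition polys_over :: "'a::zero set \<Rightarrow> 'a poly set" where
  "polys_over A = {p. \<forall>i. coeff p i \<in> A}"

definition adjoin :: "'a::comm_ring_1 set \<Rightarrow> 'a \<Rightarrow> 'a set" where
  "adjoin A x = (\<lambda>p. poly p x) ` polys_over A"

definition unit_separated :: "'a::comm_ring_1 set \<Rightarrow> bool" where
  "unit_separated A \<longleftrightarrow> (\<forall>a\<in>A. a \<noteq> 0 \<longrightarrow> (\<exists>I u. finite_quotient A I \<and> u \<in> A \<and> a * u - 1 \<in> I))"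

section \<open>Subrings, and polynomials with coefficients in them\<close>

context
  fixes A :: "'a::comm_ring_1 set"
  assumes A: "subring_set A"
begin

lemma subring_one: "1 \<in> A"
  and subring_diff: "x \<in> A \<Longrightarrow> y \<in> A \<Longrightarrow> x - y \<in> A"
  and subring_mult: "x \<in> A \<Longrightarrow> y \<in> A \<Longrightarrow> x * y \<in> A"
  using A by (auto simp: subring_set_def)

lemma subring_zero: "0 \<in> A"
  using subring_diff[OF subring_one subring_one] by simp

lemma subring_uminus: "x \<in> A \<Longrightarrow> - x \<in> A"
  using subring_diff[OF subring_zero, of x] by simp

lemma subring_add: "x \<in> A \<Longrightarrow> y \<in> A \<Longrightarrow> x + y \<in> A"
  using subring_diff[OF _ subring_uminus, of x y] by simp

lemma subring_power: "x \<in> A \<Longrightarrow> x ^ n \<in> A"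
  by (induction n) (auto intro: subring_one subring_mult)

lemma subring_sum: "(\<And>i. i \<in> S \<Longrightarrow> f i \<in> A) \<Longrightarrow> sum f S \<in> A"
  by (induction S rule: infinite_finite_induct) (auto intro: subring_zero subring_add)

lemma subring_prod: "(\<And>i. i \<in> S \<Longrightarrow> f i \<in> A) \<Longrightarrow> prod f S \<in> A"
  by (induction S rule: infinite_finite_induct) (auto intro: subring_one subring_mult)

lemma polys_over_add: "p \<in> polys_over A \<Longrightarrow> q \<in> polys_over A \<Longrightarrow> p + q \<in> polys_over A"
  by (auto simp: polys_over_def intro: subring_add)

lemma polys_over_diff: "p \<in> polys_over A \<Longrightarrow> q \<in> polys_over A \<Longrightarrow> p - q \<in> polys_over A"
  by (auto simp: polys_over_def intro: subring_diff)

lemma polys_over_uminus: "p \<in> polys_over A \<Longrightarrow> - p \<in> polys_over A"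
  by (auto simp: polys_over_def intro: subring_uminus)

lemma polys_over_mult: "p \<in> polys_over A \<Longrightarrow> q \<in> polys_over A \<Longrightarrow> p * q \<in> polys_over A"
  by (auto simp: polys_over_def coeff_mult intro!: subring_sum subring_mult)

lemma polys_over_smult: "a \<in> A \<Longrightarrow> q \<in> polys_over A \<Longrightarrow> smult a q \<in> polys_over A"
  by (auto simp: polys_over_def intro!: subring_mult)

lemma polys_over_monom: "a \<in> A \<Longrightarrow> monom a n \<in> polys_over A"
  by (auto simp: polys_over_def intro: subring_zero)

lemma polys_over_0: "0 \<in> polys_over A"
  by (auto simp: polys_over_def intro: subring_zero)

lemma polys_over_pCons: "a \<in> A \<Longrightarrow> p \<in> polys_over A \<Longrightarrow> pCons a p \<in> polys_over A"
  by (auto simp: polys_over_def coeff_pCons split: nat.split)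

lemma polys_over_1: "1 \<in> polys_over A"
  unfolding one_pCons by (intro polys_over_pCons polys_over_0 subring_one)

lemma subset_adjoin: "A \<subseteq> adjoin A x"
proof
  fix a assume "a \<in> A"
  then have "[:a:] \<in> polys_over A" by (intro polys_over_pCons polys_over_0)
  then show "a \<in> adjoin A x" unfolding adjoin_def by force
qed

lemma generator_in_adjoin: "x \<in> adjoin A x"
proof -
  have "[:0, 1:] \<in> polys_over A"
    by (intro polys_over_pCons polys_over_0 subring_zero subring_one)
  then show ?thesis unfolding adjoin_def by force
qed

lemma subring_adjoin: "subring_set (adjoin A x)"
  unfolding subring_set_def
proof (intro conjI ballI)
  show "1 \<in> adjoin A x" using subset_adjoin subring_one by blast
  fix y z assume "y \<in> adjoin A x" "z \<in> adjoin A x"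
  then obtain p q where p: "p \<in> polys_over A" "y = poly p x" and q: "q \<in> polys_over A" "z = poly q x"
    by (auto simp: adjoin_def)
  have "y - z = poly (p - q) x" "y * z = poly (p * q) x" by (simp_all add: p q)
  then show "y - z \<in> adjoin A x" "y * z \<in> adjoin A x"
    unfolding adjoin_def using polys_over_diff polys_over_mult p q by blast+
qed

end

text \<open>Ordinary division would need the inverse of \<open>lead_coeff p\<close>. Scaling
  \<open>f\<close> by one more factor of it at each step lets the leading terms cancel inside A;
  \<open>k\<close> counts the steps.\<close>

lemma pseudo_division_over:
  fixes A :: "'a::comm_ring_1 set"
  assumes A: "subring_set A" and p: "p \<in> polys_over A" and p0: "p \<noteq> 0"
  shows "f \<in> polys_over A \<Longrightarrow> \<exists>k q r. q \<in> polys_over A \<and> r \<in> polys_over A \<and>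
    smult (lead_coeff p ^ k) f = p * q + r \<and> (r = 0 \<or> degree r < degree p)"
proof (induction "degree f" arbitrary: f rule: less_induct)
  case less
  show ?case
  proof (cases "f = 0 \<or> degree f < degree p")
    case True
    then show ?thesis
      using less.prems polys_over_0[OF A] by (intro exI[of _ 0] exI[of _ f]) auto
  next
    case False
    define c where "c = lead_coeff p"
    define m where "m = monom (lead_coeff f) (degree f - degree p)"
    define h where "h = smult c f - p * m"
    have cA: "c \<in> A" and lA: "lead_coeff f \<in> A"
      using p less.prems by (auto simp: c_def polys_over_def)
    have mA: "m \<in> polys_over A" unfolding m_def by (intro polys_over_monom A lA)
    have hA: "h \<in> polys_over A" unfolding h_def
      by (intro polys_over_diff polys_over_smult polys_over_mult A cA p mA less.prems)
    have "coeff (m * p) (degree f) = lead_coeff f * c"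
      using False by (simp add: m_def coeff_monom_mult c_def)
    then have eq: "coeff (p * m) (degree f) = c * lead_coeff f"
      by (simp only: mult.commute)
    have "degree (p * m) \<le> degree f"
      using degree_mult_le[of p m] degree_monom_le[of "lead_coeff f" "degree f - degree p"] False
      unfolding m_def by linarith
    then have dh: "degree h \<le> degree f"
      unfolding h_def by (intro degree_diff_le) (auto intro: order_trans[OF degree_smult_le])
    have h0: "coeff h (degree f) = 0" by (simp add: h_def eq)
    \<comment> \<open>The zero polynomial has degree 0, so for constant \<open>f\<close> the case
      \<open>h = 0\<close> brings no drop in degree and is treated apart.\<close>
    show ?thesis
    proof (cases "h = 0")
      case True
      then have "smult (lead_coeff p ^ 1) f = p * m + 0" by (simp add: h_def c_def)
      then show ?thesis using mA polys_over_0[OF A] by blast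
    next
      case False
      then have "degree h \<noteq> degree f" using h0 by (metis leading_coeff_0_iff)
      then obtain k q r where *: "q \<in> polys_over A" "r \<in> polys_over A"
        "smult (c ^ k) h = p * q + r" "r = 0 \<or> degree r < degree p"
        using less.hyps[OF _ hA] dh unfolding c_def by force
      have "smult (c ^ Suc k) f = smult (c ^ k) (h + p * m)"
        by (simp add: h_def smult_diff_right mult.commute)
      also have "\<dots> = p * (q + smult (c ^ k) m) + r"
        by (simp add: smult_add_right * algebra_simps)
      finally have "smult (lead_coeff p ^ Suc k) f = p * (q + smult (c ^ k) m) + r"
        by (simp add: c_def)
      moreover have "q + smult (c ^ k) m \<in> polys_over A"
        by (intro polys_over_add polys_over_smult subring_power A * cA mA)
      ultimately show ?thesis using * by blast
    qed
  qed
qed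

lemma finite_polys_bounded:
  fixes F :: "'b::zero set"
  assumes "finite F"
  shows "finite {r. degree r < d \<and> (\<forall>i. coeff r i \<in> F)}"
proof (rule finite_imageD)
  let ?S = "{r. degree r < d \<and> (\<forall>i. coeff r i \<in> F)}"
  let ?c = "\<lambda>r. restrict (coeff r) {..<d}"
  have "?c ` ?S \<subseteq> {..<d} \<rightarrow>\<^sub>E F" by (intro image_subsetI restrict_PiE) auto
  then show "finite (?c ` ?S)"
    using finite_PiE[of "{..<d}" "\<lambda>_. F"] assms finite_subset by blast
  show "inj_on ?c ?S"
  proof (rule inj_onI)
    fix r s assume rs: "r \<in> ?S" "s \<in> ?S" and eq: "?c r = ?c s"
    show "r = s"
    proof (rule poly_eqI)
      fix n
      show "coeff r n = coeff s n"
      proof (cases "n < d")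
        case True
        then show ?thesis using fun_cong[OF eq, of n] by simp
      next
        case False
        then show ?thesis using rs by (simp add: coeff_eq_0)
      qed
    qed
  qed
qed

section \<open>Ideals of finite index in A and their extensions to A[X]\<close>

context
  fixes A I :: "'a::comm_ring_1 set"
  assumes A: "subring_set A" and I: "finite_quotient A I"
begin

lemma ideal_subset: "x \<in> I \<Longrightarrow> x \<in> A"
  and ideal_zero: "0 \<in> I"
  and ideal_proper: "1 \<notin> I"
  and ideal_diff: "x \<in> I \<Longrightarrow> y \<in> I \<Longrightarrow> x - y \<in> I"
  and ideal_mult: "a \<in> A \<Longrightarrow> x \<in> I \<Longrightarrow> a * x \<in> I"
  and ideal_finite: "\<exists>F. finite F \<and> F \<subseteq> A \<and> (\<forall>x\<in>A. \<exists>y\<in>F. x - y \<in> I)"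
  using I unfolding finite_quotient_def by blast+

lemma ideal_mult_right: "a \<in> A \<Longrightarrow> x \<in> I \<Longrightarrow> x * a \<in> I"
  using ideal_mult[of a x] by (simp add: mult.commute)

lemma ideal_uminus: "x \<in> I \<Longrightarrow> - x \<in> I"
  using ideal_diff[OF ideal_zero, of x] by simp

lemma ideal_add: "x \<in> I \<Longrightarrow> y \<in> I \<Longrightarrow> x + y \<in> I"
  using ideal_diff[OF _ ideal_uminus, of x y] by simp

lemma ideal_sum: "(\<And>i. i \<in> S \<Longrightarrow> f i \<in> I) \<Longrightarrow> sum f S \<in> I"
  by (induction S rule: infinite_finite_induct) (auto intro: ideal_zero ideal_add)

lemma polys_over_ideal_subset: "polys_over I \<subseteq> polys_over A"
  using ideal_subset by (auto simp: polys_over_def)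

lemma polys_over_ideal_diff: "p \<in> polys_over I \<Longrightarrow> q \<in> polys_over I \<Longrightarrow> p - q \<in> polys_over I"
  by (auto simp: polys_over_def intro: ideal_diff)

lemma polys_over_ideal_mult: "p \<in> polys_over A \<Longrightarrow> q \<in> polys_over I \<Longrightarrow> p * q \<in> polys_over I"
  by (auto simp: polys_over_def coeff_mult intro!: ideal_sum ideal_mult)

lemma polys_over_ideal_monom: "a \<in> I \<Longrightarrow> monom a n \<in> polys_over I"
  by (auto simp: polys_over_def intro: ideal_zero)

lemma polys_over_ideal_0: "0 \<in> polys_over I"
  by (auto simp: polys_over_def intro: ideal_zero)

text \<open>The ideal of A[X] generated by I and p. Its residue ring is (A/I)[X] modulo the image of
  p, which is finite once the leading coefficient of p is a unit modulo I.\<close>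

definition extended_ideal :: "'a poly \<Rightarrow> 'a poly set" where
  "extended_ideal p = {i + p * q | i q. i \<in> polys_over I \<and> q \<in> polys_over A}"

lemma extended_idealI: "i \<in> polys_over I \<Longrightarrow> q \<in> polys_over A \<Longrightarrow> i + p * q \<in> extended_ideal p"
  unfolding extended_ideal_def by blast

lemma polys_over_ideal_subset_extended: "i \<in> polys_over I \<Longrightarrow> i \<in> extended_ideal p"
  using extended_idealI[of i 0 p] polys_over_0[OF A] by simp

lemma extended_ideal_diff:
  assumes "f \<in> extended_ideal p" "g \<in> extended_ideal p"
  shows "f - g \<in> extended_ideal p"
proof -
  obtain i q j r where *: "i \<in> polys_over I" "q \<in> polys_over A" "f = i + p * q"
    "j \<in> polys_over I" "r \<in> polys_over A" "g = j + p * r"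
    using assms unfolding extended_ideal_def by blast
  have "f - g = (i - j) + p * (q - r)" by (simp add: * algebra_simps)
  then show ?thesis using extended_idealI[OF polys_over_ideal_diff polys_over_diff[OF A]] * by metis
qed

lemma extended_ideal_mult:
  assumes "g \<in> polys_over A" "f \<in> extended_ideal p"
  shows "g * f \<in> extended_ideal p"
proof -
  obtain i q where *: "i \<in> polys_over I" "q \<in> polys_over A" "f = i + p * q"
    using assms unfolding extended_ideal_def by blast
  have "g * f = g * i + p * (g * q)" by (simp add: * algebra_simps)
  then show ?thesis
    using extended_idealI[OF polys_over_ideal_mult polys_over_mult[OF A]] * assms(1) by metis
qed

lemma extended_ideal_add:
  assumes "f \<in> extended_ideal p" "g \<in> extended_ideal p"
  shows "f + g \<in> extended_ideal p"
  using extended_ideal_diff[OF assms(1) extended_ideal_mult[OF polys_over_uminus[OF A polys_over_1[OF A]] assms(2)]]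
  by simp

section \<open>Division by a polynomial whose leading coefficient is a unit modulo I\<close>

context
  fixes p :: "'a poly" and u :: 'a
  assumes p: "p \<in> polys_over A" and deg: "degree p > 0"
    and u: "u \<in> A" and unit: "lead_coeff p * u - 1 \<in> I"
begin

lemma lead_coeff_in: "lead_coeff p \<in> A"
  using p by (auto simp: polys_over_def)

lemma lead_coeff_cancel:
  assumes "x \<in> A" "lead_coeff p * x \<in> I"
  shows "x \<in> I"
proof -
  have "u * (lead_coeff p * x) - x * (lead_coeff p * u - 1) \<in> I"
    by (intro ideal_diff ideal_mult u assms unit)
  then show ?thesis by (simp add: algebra_simps)
qed

text \<open>Modulo I, the product of p with a nonzero polynomial has positive degree and cannot be
  1. Concretely, 1 = i + p q forces all coefficients of q into I, from the top down, and then also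
  the constant coefficient 1 of i + p q.\<close>

lemma extended_ideal_proper: "1 \<notin> extended_ideal p"
proof
  assume "1 \<in> extended_ideal p"
  then obtain i q where i: "i \<in> polys_over I" and q: "q \<in> polys_over A" and eq: "1 = i + p * q"
    unfolding extended_ideal_def by blast
  have coeffs: "coeff q m \<in> A" "coeff p m \<in> A" "coeff i m \<in> I" for m
    using p q i by (auto simp: polys_over_def)
  have high: "coeff (p * q) m \<in> I" if "m > 0" for m
  proof -
    have "coeff (p * q) m = - coeff i m"
      using that arg_cong[OF eq, of "\<lambda>f. coeff f m"] by (simp add: eq_neg_iff_add_eq_0 add.commute)
    then show ?thesis using coeffs ideal_uminus by simp
  qed
  \<comment> \<open>Descending induction on m. The coefficient of p q at degree p + m is
    \<open>lead_coeff p * coeff q m\<close> plus terms with higher coefficients of q; it lies in I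
    because degree p + m is positive.\<close>
  have "coeff q m \<in> I" for m
  proof (induction "Suc (degree q) - m" arbitrary: m rule: less_induct)
    case less
    show ?case
    proof (cases "m > degree q")
      case True
      then show ?thesis by (simp add: coeff_eq_0 ideal_zero)
    next
      case False
      let ?d = "degree p"
      have "coeff (p * q) (?d + m) = (\<Sum>j\<le>?d + m. coeff p j * coeff q (?d + m - j))"
        by (simp add: coeff_mult)
      also have "\<dots> = (\<Sum>j\<le>?d. coeff p j * coeff q (?d + m - j))"
        by (intro sum.mono_neutral_right) (auto simp: coeff_eq_0)
      also have "\<dots> = (\<Sum>j<?d. coeff p j * coeff q (?d + m - j)) + lead_coeff p * coeff q m"
        by (simp add: lessThan_Suc_atMost[symmetric])
      finally have "lead_coeff p * coeff q m
          = coeff (p * q) (?d + m) - (\<Sum>j<?d. coeff p j * coeff q (?d + m - j))" by simp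
      also have "\<dots> \<in> I"
      proof (intro ideal_diff high ideal_sum ideal_mult coeffs)
        fix j assume "j \<in> {..<?d}"
        then show "coeff q (?d + m - j) \<in> I" using False by (intro less) auto
      qed (use deg in auto)
      finally show ?thesis by (rule lead_coeff_cancel[OF coeffs(1)])
    qed
  qed
  then have "coeff (i + p * q) 0 \<in> I"
    by (auto simp: coeff_mult intro!: ideal_add ideal_mult coeffs)
  then show False using ideal_proper by (simp add: eq[symmetric])
qed

text \<open>Long division by p, with \<open>u\<close> in the place of the inverse of the leading
  coefficient.\<close>

lemma extended_ideal_reduce:
  "f \<in> polys_over A \<Longrightarrow> \<exists>r\<in>polys_over A. degree r < degree p \<and> f - r \<in> extended_ideal p"
proof (induction "degree f" arbitrary: f rule: less_induct)
  case less
  have zero: "0 \<in> extended_ideal p"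
    by (intro polys_over_ideal_subset_extended polys_over_ideal_0)
  show ?case
  proof (cases "degree f < degree p")
    case True
    then show ?thesis using less.prems zero by (intro bexI[of _ f]) auto
  next
    case False
    define l where "l = lead_coeff f"
    have l: "l \<in> A" using less.prems by (auto simp: l_def polys_over_def)
    define m where "m = monom (u * l) (degree f - degree p)"
    \<comment> \<open>Subtracting \<open>p * m\<close> leaves the top coefficient
      \<open>l - lead_coeff p * u * l\<close>, which lies in I but need not vanish; \<open>e\<close>
      cancels it exactly.\<close>
    define e where "e = monom (l * (lead_coeff p * u - 1)) (degree f)"
    define h where "h = f - p * m + e"
    have m: "m \<in> polys_over A" unfolding m_def by (intro polys_over_monom A subring_mult u l)
    have e: "e \<in> polys_over I" unfolding e_def by (intro polys_over_ideal_monom ideal_mult l unit)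
    have h: "h \<in> polys_over A" unfolding h_def
      using e polys_over_ideal_subset
      by (intro polys_over_add polys_over_diff polys_over_mult A p m less.prems) auto
    have "coeff (m * p) (degree f) = u * l * lead_coeff p"
      using False by (simp add: m_def coeff_monom_mult)
    then have "coeff (p * m) (degree f) = lead_coeff p * u * l"
      by (simp only: mult.commute[of p m] mult_ac)
    then have h0: "coeff h (degree f) = 0"
      by (simp add: h_def e_def l_def algebra_simps)
    have "degree (p * m) \<le> degree f"
      using degree_mult_le[of p m] degree_monom_le[of "u * l" "degree f - degree p"] False
      unfolding m_def by linarith
    then have dh: "degree h \<le> degree f"
      unfolding h_def e_def by (intro degree_add_le degree_diff_le degree_monom_le) auto
    have "degree h < degree f"
    proof (rule ccontr)
      assume "\<not> degree h < degree f"
      then have d: "degree h = degree f" using dh by simp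
      then have "h = 0" using h0 by (metis leading_coeff_0_iff)
      then show False using d False deg by simp
    qed
    then obtain r where r: "r \<in> polys_over A" "degree r < degree p" "h - r \<in> extended_ideal p"
      using less.hyps h by blast
    have "f - r = (h - r) + (p * m - e)" by (simp add: h_def)
    also have "\<dots> \<in> extended_ideal p"
      using extended_idealI[OF polys_over_ideal_0 m, of p] polys_over_ideal_subset_extended[OF e]
      by (intro extended_ideal_add extended_ideal_diff r) auto
    finally show ?thesis using r by blast
  qed
qed

lemma extended_ideal_finite:
  "\<exists>F. finite F \<and> F \<subseteq> polys_over A \<and> (\<forall>f\<in>polys_over A. \<exists>g\<in>F. f - g \<in> extended_ideal p)"
proof -
  obtain F where F: "finite F" "F \<subseteq> A" and rep: "\<And>x. x \<in> A \<Longrightarrow> \<exists>y\<in>F. x - y \<in> I"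
    using ideal_finite by blast
  \<comment> \<open>The coefficients from degree p on are exactly 0, and F need not contain
    0.\<close>
  define G where "G = {r. degree r < degree p \<and> (\<forall>i. coeff r i \<in> insert 0 F)}"
  have "finite G" unfolding G_def using F by (intro finite_polys_bounded) auto
  moreover have "G \<subseteq> polys_over A" 
  proof
    fix r assume "r \<in> G"
    then have r: "\<And>i. coeff r i \<in> insert 0 F" unfolding G_def by blast
    have "insert 0 F \<subseteq> A" using F subring_zero[OF A] by blast
    then have "coeff r i \<in> A" for i using r[of i] by blast
    then show "r \<in> polys_over A" by (simp add: polys_over_def)
  qed
  moreover have "\<exists>g\<in>G. f - g \<in> extended_ideal p" if f: "f \<in> polys_over A" for f
  proof -
    obtain r where r: "r \<in> polys_over A" "degree r < degree p" "f - r \<in> extended_ideal p"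
      using extended_ideal_reduce[OF f] by blast
    have "\<exists>y\<in>F. x - y \<in> I" if "x \<in> A" for x using rep that .
    then obtain \<rho> where \<rho>: "\<And>x. x \<in> A \<Longrightarrow> \<rho> x \<in> F \<and> x - \<rho> x \<in> I" by metis
    define g where "g = (\<Sum>i<degree p. monom (\<rho> (coeff r i)) i)"
    have cg: "coeff g j = (if j < degree p then \<rho> (coeff r j) else 0)" for j
      by (simp add: g_def coeff_sum)
    have "degree g \<le> degree p - 1"
      by (rule degree_le) (use deg in \<open>auto simp: cg\<close>)
    then have "degree g < degree p" using deg by linarith
    have cr: "coeff r j \<in> A" for j using r by (auto simp: polys_over_def)
    have "g \<in> G" using \<open>degree g < degree p\<close> \<rho> cr by (auto simp: G_def cg)
    have "r - g \<in> polys_over I"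
      unfolding polys_over_def using r \<rho> cr by (auto simp: cg coeff_eq_0 ideal_zero)
    then have "(f - r) + (r - g) \<in> extended_ideal p"
      by (intro extended_ideal_add r polys_over_ideal_subset_extended)
    then show ?thesis using \<open>g \<in> G\<close> by auto
  qed
  ultimately show ?thesis by blast
qed

text \<open>
  The hypothesis on x says that p becomes a minimal polynomial of x after inverting its leading
  coefficient; it holds trivially if x is transcendental.
\<close>

lemma finite_quotient_adjoin:
  assumes ker: "\<And>f. f \<in> polys_over A \<Longrightarrow> poly f x = 0 \<Longrightarrow>
    \<exists>k. \<exists>q\<in>polys_over A. smult (lead_coeff p ^ k) f = p * q"
  shows "finite_quotient (adjoin A x) ((\<lambda>f. poly f x) ` extended_ideal p)"
proof -
  let ?J = "(\<lambda>f. poly f x) ` extended_ideal p"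
  have sub: "extended_ideal p \<subseteq> polys_over A"
    using polys_over_ideal_subset
    by (auto simp: extended_ideal_def intro!: polys_over_add polys_over_mult A p)
  \<comment> \<open>If f(x) = 1 with f in the extended ideal, then 1 - f vanishes at x, so p divides
    l^k (1 - f), where l is the leading coefficient of p. Hence l^k lies in the extended ideal, and
    so does 1, as u inverts l modulo I.\<close>
  have "1 \<notin> ?J"
  proof
    assume "1 \<in> ?J"
    then obtain f where f: "f \<in> extended_ideal p" "1 = poly f x" by blast
    have "1 - f \<in> polys_over A" using f sub by (intro polys_over_diff polys_over_1 A) auto
    moreover have "poly (1 - f) x = 0" using f by simp
    ultimately obtain k q where q: "q \<in> polys_over A" and eq: "smult (lead_coeff p ^ k) (1 - f) = p * q"
      using ker by blast
    define c where "c = [:lead_coeff p ^ k:]"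
    have c: "c \<in> polys_over A" unfolding c_def
      by (intro polys_over_pCons polys_over_0 subring_power A lead_coeff_in)
    have "c - c * f = p * q"
      using eq by (simp add: c_def smult_diff_right)
    then have "c = c * f + (0 + p * q)" by (simp add: algebra_simps)
    also have "\<dots> \<in> extended_ideal p"
      by (intro extended_ideal_add extended_ideal_mult extended_idealI f c q polys_over_ideal_0)
    finally have cE: "c \<in> extended_ideal p" .
    have "(lead_coeff p * u) ^ j - 1 \<in> I" for j
    proof (induction j)
      case (Suc j)
      have "(lead_coeff p * u) * ((lead_coeff p * u) ^ j - 1) + (lead_coeff p * u - 1) \<in> I"
        by (intro ideal_add ideal_mult subring_mult A lead_coeff_in u Suc unit)
      then show ?case by (simp add: algebra_simps)
    qed (simp add: ideal_zero)
    then have "1 - (lead_coeff p * u) ^ k \<in> I" using ideal_uminus by fastforce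
    then have "monom (1 - (lead_coeff p * u) ^ k) 0 \<in> extended_ideal p"
      by (intro polys_over_ideal_subset_extended polys_over_ideal_monom)
    moreover have "[:u ^ k:] \<in> polys_over A"
      by (intro polys_over_pCons polys_over_0 subring_power A u)
    ultimately have "monom (1 - (lead_coeff p * u) ^ k) 0 + [:u ^ k:] * c \<in> extended_ideal p"
      using cE by (intro extended_ideal_add extended_ideal_mult) auto
    also have "monom (1 - (lead_coeff p * u) ^ k) 0 + [:u ^ k:] * c = 1"
      by (simp add: c_def monom_0 power_mult_distrib one_pCons mult.commute)
    finally show False using extended_ideal_proper by blast
  qed
  moreover have "0 \<in> ?J"
    using polys_over_ideal_subset_extended[OF polys_over_ideal_0, of p] by force
  moreover have "y - z \<in> ?J" if "y \<in> ?J" "z \<in> ?J" for y z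
    using that extended_ideal_diff by (force simp flip: poly_diff)
  moreover have "a * y \<in> ?J" if "a \<in> adjoin A x" "y \<in> ?J" for a y
    using that extended_ideal_mult unfolding adjoin_def by (force simp flip: poly_mult)
  moreover have "\<exists>F. finite F \<and> F \<subseteq> adjoin A x \<and> (\<forall>y\<in>adjoin A x. \<exists>z\<in>F. y - z \<in> ?J)"
  proof -
    obtain F where F: "finite F" "F \<subseteq> polys_over A"
      "\<forall>f\<in>polys_over A. \<exists>g\<in>F. f - g \<in> extended_ideal p"
      using extended_ideal_finite by blast
    then show ?thesis unfolding adjoin_def
      by (intro exI[of _ "(\<lambda>f. poly f x) ` F"]) (force simp flip: poly_diff)
  qed
  moreover have "?J \<subseteq> adjoin A x" using sub by (auto simp: adjoin_def)
  ultimately show ?thesis unfolding finite_quotient_def by blast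
qed

end
end

section \<open>Passing from A to A[x]\<close>

text \<open>Replaces the inverse of b over the field of fractions. Among the multiples r(x) of b
  with r nonzero of degree below that of p, take one with r of least degree. If r is not constant,
  pseudo-division of p by r yields either a multiple with r of smaller degree, or a quotient q that
  vanishes at x and has smaller degree than p.\<close>

lemma algebraic_divides_constant:
  fixes A :: "'a::idom set"
  assumes A: "subring_set A"
    and p: "p \<in> polys_over A" "p \<noteq> 0" "poly p x = 0"
    and minimal: "\<And>f. f \<in> polys_over A \<Longrightarrow> f \<noteq> 0 \<Longrightarrow> poly f x = 0 \<Longrightarrow> degree p \<le> degree f"
    and b: "b \<in> adjoin A x" "b \<noteq> 0"
  shows "\<exists>s\<in>adjoin A x. b * s \<in> A \<and> b * s \<noteq> 0"
proof -
  define P where "P r \<longleftrightarrow> r \<in> polys_over A \<and> r \<noteq> 0 \<and> degree r < degree p \<and>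
      (\<exists>s\<in>adjoin A x. b * s = poly r x)" for r
  obtain h where h: "h \<in> polys_over A" "b = poly h x" using b by (auto simp: adjoin_def)
  obtain k q r where r: "r \<in> polys_over A" "smult (lead_coeff p ^ k) h = p * q + r"
    "r = 0 \<or> degree r < degree p"
    using pseudo_division_over[OF A p(1,2) h(1)] by blast
  have rx: "lead_coeff p ^ k * b = poly r x"
    using arg_cong[OF r(2), of "\<lambda>f. poly f x"] by (simp add: p h)
  have "lead_coeff p ^ k \<in> A" using p by (intro subring_power A) (auto simp: polys_over_def)
  \<comment> \<open>The minimization starts from a power of \<open>lead_coeff p\<close> times b; its
    value r(x) is nonzero because b is.\<close>
  then have "P r"
    unfolding P_def using r rx b p subset_adjoin[OF A, of x]
    by (auto simp: mult.commute intro!: bexI[of _ "lead_coeff p ^ k"])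
  then obtain r where "P r" and least: "\<And>r'. P r' \<Longrightarrow> degree r \<le> degree r'"
    using exists_least_iff[of "\<lambda>n. \<exists>r. P r \<and> degree r = n"] by (metis not_le)
  then obtain s where r: "r \<in> polys_over A" "r \<noteq> 0" "degree r < degree p"
    and s: "s \<in> adjoin A x" "b * s = poly r x" unfolding P_def by blast
  have rx: "poly r x \<noteq> 0" using minimal r by force
  have "degree r = 0"
  proof (rule ccontr)
    assume pos: "degree r \<noteq> 0"
    obtain k q r' where r': "q \<in> polys_over A" "r' \<in> polys_over A"
      "smult (lead_coeff r ^ k) p = r * q + r'" "r' = 0 \<or> degree r' < degree r"
      using pseudo_division_over[OF A r(1,2) p(1)] by blast
    have ev: "poly r x * poly q x + poly r' x = 0"
      using arg_cong[OF r'(3), of "\<lambda>f. poly f x"] by (simp add: p)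
    show False
    proof (cases "r' = 0")
      case True
      then have "poly q x = 0" using ev rx by simp
      have "r * q = smult (lead_coeff r ^ k) p" using r' True by simp
      then have "r * q \<noteq> 0" "degree (r * q) = degree p" using p r by auto
      then have "q \<noteq> 0" "degree r + degree q = degree p"
        using degree_mult_eq[OF r(2), of q] by auto
      then show False using minimal[OF r'(1) _ \<open>poly q x = 0\<close>] pos by simp
    next
      case False
      have "poly r' x = b * (s * - poly q x)"
        using ev by (simp add: mult.assoc[symmetric] s eq_neg_iff_add_eq_0 add.commute)
      moreover have "poly q x \<in> adjoin A x" using r' by (auto simp: adjoin_def)
      then have "s * - poly q x \<in> adjoin A x"
        using subring_adjoin[OF A] by (intro subring_mult subring_uminus s) auto
      ultimately have "P r'" unfolding P_def using r' r False by force
      then show False using least False r' by force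
    qed
  qed
  then obtain a where "r = [:a:]" by (rule degree_eq_zeroE)
  then have "b * s = a" "a \<in> A" "a \<noteq> 0" using s r by (auto simp: polys_over_def coeff_pCons split: nat.splits)
  then show ?thesis using s by blast
qed

text \<open>In the algebraic case two elements have to become units: the leading coefficient of p,
  and a multiple of b that lies in A. In the transcendental case the polynomial is X h - 1, so that
  x itself becomes the inverse of b = h(x).\<close>

lemma unit_separated_adjoin:
  fixes A :: "'a::idom set"
  assumes A: "subring_set A" and sep: "unit_separated A"
  shows "unit_separated (adjoin A x)"
  unfolding unit_separated_def
proof (intro ballI impI)
  fix b assume b: "b \<in> adjoin A x" "b \<noteq> 0"
  show "\<exists>J u. finite_quotient (adjoin A x) J \<and> u \<in> adjoin A x \<and> b * u - 1 \<in> J"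
  proof (cases "\<exists>f\<in>polys_over A. f \<noteq> 0 \<and> poly f x = 0")
    case True
    then obtain p where p: "p \<in> polys_over A" "p \<noteq> 0" "poly p x = 0"
      and minimal: "\<And>f. f \<in> polys_over A \<Longrightarrow> f \<noteq> 0 \<Longrightarrow> poly f x = 0 \<Longrightarrow> degree p \<le> degree f"
      using exists_least_iff[of "\<lambda>n. \<exists>f\<in>polys_over A. f \<noteq> 0 \<and> poly f x = 0 \<and> degree f = n"]
      by (metis not_le)
    obtain s where s: "s \<in> adjoin A x" "b * s \<in> A" "b * s \<noteq> 0"
      using algebraic_divides_constant[OF A p minimal b] by blast
    define c where "c = lead_coeff p"
    have c: "c \<in> A" "c \<noteq> 0" using p by (auto simp: c_def polys_over_def)
    \<comment> \<open>Inverting the product makes both factors units: \<open>b * s * w\<close>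
      inverts \<open>c\<close>, and \<open>s * c * w\<close> inverts \<open>b\<close>.\<close>
    have "c * (b * s) \<in> A" "c * (b * s) \<noteq> 0" using c s by (auto intro: subring_mult[OF A])
    then obtain I w where I: "finite_quotient A I" and w: "w \<in> A" "c * (b * s) * w - 1 \<in> I"
      using sep unfolding unit_separated_def by blast
    have deg: "degree p > 0"
    proof (rule ccontr)
      assume "\<not> degree p > 0"
      then obtain a where "p = [:a:]" using degree_eq_zeroE by blast
      then show False using p by simp
    qed
    have u: "b * s * w \<in> A" "lead_coeff p * (b * s * w) - 1 \<in> I"
      using w s subring_mult[OF A, of "b * s" w] by (simp_all add: c_def mult.assoc)
    have ker: "\<exists>k. \<exists>q\<in>polys_over A. smult (lead_coeff p ^ k) f = p * q"
      if f: "f \<in> polys_over A" "poly f x = 0" for f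
    proof -
      obtain k q r where r: "q \<in> polys_over A" "r \<in> polys_over A"
        "smult (lead_coeff p ^ k) f = p * q + r" "r = 0 \<or> degree r < degree p"
        using pseudo_division_over[OF A p(1,2) f(1)] by blast
      have "poly r x = 0"
        using arg_cong[OF r(3), of "\<lambda>f. poly f x"] by (simp add: p f)
      then have "r = 0" using minimal r by force
      then show ?thesis using r by auto
    qed
    let ?J = "(\<lambda>f. poly f x) ` extended_ideal A I p"
    have J: "finite_quotient (adjoin A x) ?J"
      by (rule finite_quotient_adjoin[OF A I p(1) deg u ker])
    have "s * c * w \<in> adjoin A x"
      using subset_adjoin[OF A, of x] c w subring_adjoin[OF A, of x]
      by (intro subring_mult s) auto
    moreover have "[:c * (b * s) * w - 1:] \<in> extended_ideal A I p"
      using w I by (intro polys_over_ideal_subset_extended[OF A I])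
        (auto simp: polys_over_def coeff_pCons ideal_zero[OF A I] split: nat.split)
    then have "b * (s * c * w) - 1 \<in> ?J" by (force simp: mult_ac)
    ultimately show ?thesis using J by blast
  next
    case False
    obtain h where h: "h \<in> polys_over A" "b = poly h x" using b by (auto simp: adjoin_def)
    have "h \<noteq> 0" using b h by auto
    then have "lead_coeff h \<noteq> 0" "lead_coeff h \<in> A" using h by (auto simp: polys_over_def)
    then obtain I u where I: "finite_quotient A I" and u: "u \<in> A" "lead_coeff h * u - 1 \<in> I"
      using sep unfolding unit_separated_def by blast
    define p where "p = pCons (-1) h"
    have p: "p \<in> polys_over A"
      unfolding p_def by (intro polys_over_pCons subring_uminus subring_one A h)
    have deg: "degree p > 0" and lc: "lead_coeff p * u - 1 \<in> I"
      using u \<open>h \<noteq> 0\<close> by (auto simp: p_def)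
    have ker: "\<exists>k. \<exists>q\<in>polys_over A. smult (lead_coeff p ^ k) f = p * q"
      if f: "f \<in> polys_over A" "poly f x = 0" for f
      using False f polys_over_0[OF A] by (intro exI[of _ 0] bexI[of _ 0]) auto
    let ?J = "(\<lambda>f. poly f x) ` extended_ideal A I p"
    have J: "finite_quotient (adjoin A x) ?J"
      by (rule finite_quotient_adjoin[OF A I p deg u(1) lc ker])
    have "0 + p * 1 \<in> extended_ideal A I p"
      by (intro extended_idealI[OF A I] polys_over_ideal_0[OF A I] polys_over_1 A)
    then have "poly p x \<in> ?J" by auto
    then have "b * x - 1 \<in> ?J" by (simp add: p_def h mult.commute)
    then show ?thesis using J generator_in_adjoin[OF A, of x] by blast
  qed
qed

section \<open>The integers, and the induction over the generators of the ring\<close>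

lemma unit_separated_Ints: "unit_separated (\<int> :: 'a::{idom, ring_char_0} set)"
  unfolding unit_separated_def
proof (intro ballI impI)
  fix a :: 'a assume "a \<in> \<int>" "a \<noteq> 0"
  then obtain n where n: "a = of_int n" "n \<noteq> 0" by (auto elim!: Ints_cases)
  \<comment> \<open>Modulo |n| + 1 the number |n| is -1, so \<open>- sgn n\<close> inverts n. The
    modulus is at least 2, so the ideal is proper.\<close>
  define m where "m = \<bar>n\<bar> + 1"
  define I :: "'a set" where "I = range (\<lambda>k. of_int (m * k))"
  have memI: "of_int k \<in> I \<longleftrightarrow> m dvd k" for k
    unfolding I_def by (auto simp: dvd_def simp del: of_int_mult)
  have "finite_quotient \<int> I"
    unfolding finite_quotient_def
  proof (intro conjI ballI)
    show "I \<subseteq> \<int>" unfolding I_def by auto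
    show "0 \<in> I" "1 \<notin> I" using memI[of 0] memI[of 1] n by (auto simp: m_def)
    show "x - y \<in> I" if xy: "x \<in> I" "y \<in> I" for x y
    proof -
      obtain j k where "x = of_int (m * j)" "y = of_int (m * k)" using xy unfolding I_def by blast
      then have "x - y = of_int (m * (j - k))" by (simp add: algebra_simps)
      then show ?thesis unfolding I_def by blast
    qed
    show "c * x \<in> I" if cx: "c \<in> \<int>" "x \<in> I" for c x
    proof -
      obtain j k where "c = of_int j" "x = of_int (m * k)"
        using cx unfolding I_def by (auto elim!: Ints_cases)
      then have "c * x = of_int (m * (j * k))" by (simp add: algebra_simps)
      then show ?thesis unfolding I_def by blast
    qed
    show "\<exists>F. finite F \<and> F \<subseteq> \<int> \<and> (\<forall>x\<in>\<int>. \<exists>y\<in>F. x - y \<in> I)"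
    proof (intro exI conjI ballI)
      show "finite (of_int ` {0..<m} :: 'a set)" "of_int ` {0..<m} \<subseteq> (\<int> :: 'a set)" by auto
      fix x :: 'a assume "x \<in> \<int>"
      then obtain k where "x = of_int k" by (auto elim: Ints_cases)
      moreover have "of_int k - of_int (k mod m) \<in> I"
        using memI[of "k - k mod m"] by (simp add: dvd_minus_mod)
      moreover have "m > 0" by (simp add: m_def)
      then have "k mod m \<in> {0..<m}" by simp
      ultimately show "\<exists>y\<in>of_int ` {0..<m}. x - y \<in> I" by blast
    qed
  qed
  moreover have "m dvd n * (- sgn n) - 1"
  proof -
    have "n * sgn n = \<bar>n\<bar>" by (simp add: abs_sgn)
    then have "n * (- sgn n) - 1 = - m" by (simp add: m_def)
    then show ?thesis by simp
  qed
  then have "a * of_int (- sgn n) - 1 \<in> I"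
    using memI[of "n * (- sgn n) - 1"] by (simp add: n)
  ultimately show "\<exists>I u. finite_quotient \<int> I \<and> u \<in> \<int> \<and> a * u - 1 \<in> I"
    by (metis Ints_of_int)
qed

lemma finitely_generated_unit_separated:
  fixes S :: "'a::{idom, ring_char_0} set"
  assumes "finite S"
  shows "\<exists>A. subring_set A \<and> S \<subseteq> A \<and> unit_separated A"
  using assms
proof (induction S rule: finite_induct)
  case empty
  have "subring_set (\<int> :: 'a set)" by (auto simp: subring_set_def)
  then show ?case using unit_separated_Ints by blast
next
  case (insert x S)
  then obtain A where A: "subring_set A" "S \<subseteq> A" "unit_separated A" by blast
  then have "insert x S \<subseteq> adjoin A x" using subset_adjoin[of A x] generator_in_adjoin[of A x] by blast
  then show ?case using subring_adjoin[OF A(1)] unit_separated_adjoin[OF A(1,3)] by blast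
qed

text \<open>The product of T is a unit modulo I. An element of T inside I would put this product,
  and hence 1, into I.\<close>

lemma finite_quotient_avoiding:
  fixes S T :: "'a::{idom, ring_char_0} set"
  assumes "finite S" "finite T" "0 \<notin> T"
  shows "\<exists>A I. subring_set A \<and> finite_quotient A I \<and> S \<union> T \<subseteq> A \<and> I \<inter> T = {}"
proof -
  obtain A where A: "subring_set A" "S \<union> T \<subseteq> A" "unit_separated A"
    using finitely_generated_unit_separated[of "S \<union> T"] assms by blast
  have TA: "prod id T \<in> A" using A by (intro subring_prod) auto
  moreover have "prod id T \<noteq> 0" using assms by auto
  ultimately obtain I u where I: "finite_quotient A I" and u: "u \<in> A" "prod id T * u - 1 \<in> I"
    using A unfolding unit_separated_def by blast
  have "t \<notin> I" if "t \<in> T" for t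
  proof
    assume t: "t \<in> I"
    have "prod id T = t * prod id (T - {t})" using assms that by (simp add: prod.remove)
    moreover have "prod id (T - {t}) \<in> A" using A by (intro subring_prod) auto
    ultimately have "prod id T * u \<in> I" using t u by (auto intro!: ideal_mult_right[OF A(1) I])
    then have "prod id T * u - (prod id T * u - 1) \<in> I" using u ideal_diff[OF A(1) I] by blast
    then show False using ideal_proper[OF A(1) I] by simp
  qed
  then show ?thesis using A I by blast
qed

section \<open>The hyperboloid model\<close>

text \<open>
  A vector v stands for the symmetric matrix with rows (v1, v2) and (v2, v3); the form below is the
  polar form of its determinant.
\<close>

definition hyp_vec :: "complex \<Rightarrow> real^3" where
  "hyp_vec z = vector [((Re z)\<^sup>2 + (Im z)\<^sup>2) / Im z, Re z / Im z, 1 / Im z]"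

definition lform :: "real^3 \<Rightarrow> real^3 \<Rightarrow> real" where
  "lform u v = (u$1 * v$3 + u$3 * v$1) / 2 - u$2 * v$2"

lemma hyp_vec_nth [simp]:
  "hyp_vec z $ 1 = ((Re z)\<^sup>2 + (Im z)\<^sup>2) / Im z" "hyp_vec z $ 2 = Re z / Im z" "hyp_vec z $ 3 = 1 / Im z"
  by (simp_all add: hyp_vec_def)

lemma lform_add_left: "lform (u + v) w = lform u w + lform v w"
  and lform_scale_left: "lform (c *\<^sub>R u) w = c * lform u w"
  and lform_diff_left: "lform (u - v) w = lform u w - lform v w"
  and lform_commute: "lform u v = lform v u"
  by (simp_all add: lform_def field_simps)

lemma lform_sum_left: "lform (sum f S) w = (\<Sum>i\<in>S. lform (f i) w)"
  by (induction S rule: infinite_finite_induct) (simp_all add: lform_add_left, simp_all add: lform_def)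

text \<open>Rests on cosh d = 1 + 2 sinh(d/2)^2. This is how distances enter the linear model: an
  isometry preserves the form on the vectors \<open>hyp_vec z\<close>.\<close>

lemma lform_hyp_vec:
  assumes "Im z > 0" "Im w > 0"
  shows "lform (hyp_vec z) (hyp_vec w) = cosh (hdist z w)"
proof -
  have s: "sinh (hdist z w / 2) = cmod (z - w) / (2 * sqrt (Im z * Im w))"
    using assms by (simp add: hdist_def)
  have "cosh (hdist z w) = cosh (hdist z w / 2) ^ 2 + sinh (hdist z w / 2) ^ 2"
    using cosh_double[of "hdist z w / 2"] by simp
  also have "\<dots> = 1 + 2 * sinh (hdist z w / 2) ^ 2" by (simp add: cosh_square_eq)
  also have "\<dots> = 1 + (cmod (z - w))\<^sup>2 / (2 * (Im z * Im w))"
    using assms by (simp add: s power_divide power_mult_distrib)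
  also have "\<dots> = lform (hyp_vec z) (hyp_vec w)"
    using assms by (simp add: lform_def cmod_power2) (simp add: field_simps power2_eq_square)
  finally show ?thesis by simp
qed

lemma hyp_vec_inj:
  assumes "Im z > 0" "Im w > 0" "hyp_vec z = hyp_vec w"
  shows "z = w"
proof -
  have "hyp_vec z $ 2 = hyp_vec w $ 2" "hyp_vec z $ 3 = hyp_vec w $ 3" by (simp_all only: assms)
  then show ?thesis using assms(1,2) by (simp add: complex_eq_iff)
qed

text \<open>The form has signature (1, 2), so it is negative definite on the orthogonal complement
  of a timelike vector. Combining the two equations and completing the square gives
  \<open>(q - r * x)\<^sup>2 + (r * y)\<^sup>2 = 0\<close>.\<close>

lemma lform_null_orthogonal:
  assumes "Im w > 0" "lform u (hyp_vec w) = 0" "lform u u = 0"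
  shows "u = 0"
proof -
  define p q r where "p = u $ 1" and "q = u $ 2" and "r = u $ 3"
  define x y where "x = Re w" and "y = Im w"
  have y: "y > 0" using assms by (simp add: y_def)
  have "(p / y + r * ((x\<^sup>2 + y\<^sup>2) / y)) / 2 - q * (x / y) = 0"
    using assms(2) by (simp add: lform_def p_def q_def r_def x_def y_def)
  moreover have "(p / y + r * ((x\<^sup>2 + y\<^sup>2) / y)) / 2 - q * (x / y)
      = (p + r * (x\<^sup>2 + y\<^sup>2) - 2 * q * x) / (2 * y)"
    using y by (simp add: field_simps)
  ultimately have 1: "p + r * (x\<^sup>2 + y\<^sup>2) = 2 * q * x" using y by simp
  have 2: "p * r = q\<^sup>2" using assms(3) by (simp add: lform_def p_def q_def r_def power2_eq_square)
  have "(q - r * x)\<^sup>2 + (r * y)\<^sup>2 = p * r + r * (r * (x\<^sup>2 + y\<^sup>2)) - r * (2 * q * x)"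
    unfolding 2 by (simp add: power2_eq_square algebra_simps)
  also have "\<dots> = 0" unfolding 1[symmetric] by (simp add: algebra_simps)
  finally have "q - r * x = 0 \<and> r * y = 0" by (simp add: sum_power2_eq_zero_iff)
  then have "r = 0" "q = 0" using y by auto
  moreover have "p = 0" using 1 \<open>r = 0\<close> \<open>q = 0\<close> by simp
  ultimately show ?thesis by (simp add: vec_eq_iff forall_3 p_def q_def r_def)
qed

text \<open>
  The three coefficients are the coordinates of v in the basis consisting of the images of
  i, 1 + i and -1 + i.
\<close>

definition frame_map :: "(complex \<Rightarrow> complex) \<Rightarrow> real^3 \<Rightarrow> real^3" where
  "frame_map f v = (2 * v$3 - v$1) *\<^sub>R hyp_vec (f \<i>) + ((v$1 - v$3 + v$2) / 2) *\<^sub>R hyp_vec (f (1 + \<i>))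
     + ((v$1 - v$3 - v$2) / 2) *\<^sub>R hyp_vec (f (- 1 + \<i>))"

definition isom_matrix :: "(complex \<Rightarrow> complex) \<Rightarrow> real^3^3" where
  "isom_matrix f = matrix (frame_map f)"

lemma isom_matrix_vector: "isom_matrix f *v v = frame_map f v"
proof -
  have "linear (frame_map f)"
    by (rule linearI) (simp_all add: frame_map_def algebra_simps add_divide_distrib diff_divide_distrib)
  then show ?thesis by (simp add: isom_matrix_def matrix_works linear_matrix_vector_mul_eq)
qed

text \<open>The frame vectors are (1, 0, 1), (2, 1, 1) and (2, -1, 1); solving for the coordinates
  of v gives the coefficients in \<open>frame_map\<close>.\<close>

lemma frame_map_id: "frame_map (\<lambda>z. z) v = v"
  by (simp add: frame_map_def vec_eq_iff forall_3 power2_eq_square field_simps)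

lemma lform_frame_map: "lform (frame_map f v) w = (2 * v$3 - v$1) * lform (hyp_vec (f \<i>)) w
    + ((v$1 - v$3 + v$2) / 2) * lform (hyp_vec (f (1 + \<i>))) w
    + ((v$1 - v$3 - v$2) / 2) * lform (hyp_vec (f (- 1 + \<i>))) w"
  by (simp add: frame_map_def lform_add_left lform_scale_left)

text \<open>The frame spans the whole space and lies on the hyperboloid. Identities between
  isometries therefore pass to their matrices after a check on points of the half-plane.\<close>

lemma matrix_eq_on_hyp_vec:
  assumes "\<And>z. Im z > 0 \<Longrightarrow> M *v hyp_vec z = N *v hyp_vec z"
  shows "M = N"
proof -
  have "M *v v = N *v v" for v
  proof -
    have "M *v frame_map (\<lambda>z. z) v = N *v frame_map (\<lambda>z. z) v"
      using assms[of \<i>] assms[of "1 + \<i>"] assms[of "- 1 + \<i>"]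
      unfolding frame_map_def matrix_vector_right_distrib matrix_vector_mult_scaleR by simp
    then show ?thesis by (simp add: frame_map_id)
  qed
  then show ?thesis by (simp add: matrix_eq)
qed

section \<open>Isometries as linear maps, and fixed points of those of finite order\<close>

lemma isometry_maps:
  assumes "f \<in> hyp_isometries"
  shows "Im z > 0 \<Longrightarrow> Im (f z) > 0"
    and "Im z > 0 \<Longrightarrow> Im w > 0 \<Longrightarrow> hdist (f z) (f w) = hdist z w"
  using assms Bij_imp_funcset[of f upper_half_plane]
  by (auto simp: hyp_isometries_def upper_half_plane_def Pi_iff)

text \<open>
  The difference of the two sides is orthogonal to the images of the frame and of z, because f
  preserves all the products involved; so it is null and orthogonal to a timelike vector.
\<close>

lemma isom_matrix_hyp_vec:
  assumes f: "f \<in> hyp_isometries" and z: "Im z > 0"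
  shows "isom_matrix f *v hyp_vec z = hyp_vec (f z)"
proof -
  define u where "u = frame_map f (hyp_vec z) - hyp_vec (f z)"
  have orth: "lform u (hyp_vec (f w)) = 0" if "Im w > 0" for w
  proof -
    have pres: "lform (hyp_vec (f a)) (hyp_vec (f w)) = lform (hyp_vec a) (hyp_vec w)"
      if "Im a > 0" for a
      using \<open>Im w > 0\<close> that by (simp add: lform_hyp_vec isometry_maps[OF f])
    have "lform u (hyp_vec (f w)) = lform (frame_map (\<lambda>z. z) (hyp_vec z) - hyp_vec z) (hyp_vec w)"
      unfolding u_def lform_diff_left lform_frame_map using z
      by (simp add: pres del: hyp_vec_nth)
    also have "\<dots> = 0" by (simp add: frame_map_id lform_def)
    finally show ?thesis .
  qed
  have orth': "lform (hyp_vec (f w)) u = 0" if "Im w > 0" for w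
    using orth[OF that] by (simp add: lform_commute)
  have "lform u u = lform (frame_map f (hyp_vec z) - hyp_vec (f z)) u"
    using u_def by (rule arg_cong[where f = "\<lambda>v. lform v u"])
  also have "\<dots> = 0"
    using orth'[of \<i>] orth'[of "1 + \<i>"] orth'[of "- 1 + \<i>"] orth'[OF z]
    by (simp add: lform_diff_left lform_frame_map del: hyp_vec_nth)
  finally have "u = 0"
    using lform_null_orthogonal[of "f \<i>" u] orth[of \<i>] isometry_maps(1)[OF f, of \<i>] by simp
  then show ?thesis by (simp add: u_def isom_matrix_vector)
qed

lemma isom_matrix_compose:
  assumes f: "f \<in> hyp_isometries" and g: "g \<in> hyp_isometries"
    and h: "h \<in> hyp_isometries" and eq: "\<And>z. Im z > 0 \<Longrightarrow> h z = f (g z)"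
  shows "isom_matrix h = isom_matrix f ** isom_matrix g"
  by (rule matrix_eq_on_hyp_vec)
    (simp add: isom_matrix_hyp_vec[OF h] isom_matrix_hyp_vec[OF f] isom_matrix_hyp_vec[OF g]
      isometry_maps(1)[OF g] eq flip: matrix_vector_mul_assoc)

lemma isom_matrix_id:
  assumes f: "f \<in> hyp_isometries" and "\<And>z. Im z > 0 \<Longrightarrow> f z = z"
  shows "isom_matrix f = mat 1"
  by (rule matrix_eq_on_hyp_vec) (simp add: isom_matrix_hyp_vec[OF f] assms)

lemma isom_matrix_eq_mat_1:
  assumes f: "f \<in> hyp_isometries" and "isom_matrix f = mat 1" and z: "Im z > 0"
  shows "f z = z"
  using isom_matrix_hyp_vec[OF f z] assms(2) hyp_vec_inj[OF isometry_maps(1)[OF f z] z] by simp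

lemma timelike_normalize:
  assumes "lform v v > 0" "v $ 3 > 0"
  shows "\<exists>w c. Im w > 0 \<and> c > 0 \<and> v = c *\<^sub>R hyp_vec w"
proof -
  define c where "c = sqrt (lform v v)"
  \<comment> \<open>Read off from the last two entries of \<open>c *\<^sub>R hyp_vec w\<close>,
    which are c Re w / Im w and c / Im w.\<close>
  define w where "w = Complex (v$2 / v$3) (c / v$3)"
  have c: "c > 0" "c\<^sup>2 = lform v v" using assms by (simp_all add: c_def)
  have w: "Re w = v$2 / v$3" "Im w = c / v$3" by (simp_all add: w_def)
  have "(v$2)\<^sup>2 + c\<^sup>2 = v$1 * v$3" unfolding c(2) by (simp add: lform_def power2_eq_square)
  then have "c * ((Re w)\<^sup>2 + (Im w)\<^sup>2) / Im w = v$1"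
    using c(1) assms(2) by (simp add: w field_simps power2_eq_square)
  then have "v = c *\<^sub>R hyp_vec w"
    using c(1) assms(2) by (simp add: vec_eq_iff forall_3 w)
  moreover have "Im w > 0" using c assms by (simp add: w)
  ultimately show ?thesis using c by blast
qed

text \<open>
  The sum of the vectors of a finite orbit is timelike and invariant.
\<close>

lemma finite_order_fixed_point:
  assumes f: "f \<in> hyp_isometries" and n: "n > 0" and per: "\<And>z. Im z > 0 \<Longrightarrow> (f ^^ n) z = z"
  shows "\<exists>w. Im w > 0 \<and> f w = w"
proof -
  have pos: "Im ((f ^^ k) \<i>) > 0" for k
    by (induction k) (simp_all add: isometry_maps(1)[OF f])
  define v where "v = (\<Sum>k<n. hyp_vec ((f ^^ k) \<i>))"
  \<comment> \<open>f shifts the orbit by one place; the new last term equals the lost first one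
    because the n-th iterate fixes i.\<close>
  have "isom_matrix f *v v = (\<Sum>k<n. hyp_vec ((f ^^ Suc k) \<i>))"
    by (simp add: v_def linear_sum[OF matrix_vector_mul_linear] isom_matrix_hyp_vec[OF f] pos)
  also have "\<dots> = v + hyp_vec ((f ^^ n) \<i>) - hyp_vec ((f ^^ 0) \<i>)"
    using sum.lessThan_Suc_shift[of "\<lambda>k. hyp_vec ((f ^^ k) \<i>)" n] by (simp add: v_def)
  also have "\<dots> = v" using per[of \<i>] by simp
  finally have inv: "isom_matrix f *v v = v" .
  have expand: "lform v u = (\<Sum>k<n. lform u (hyp_vec ((f ^^ k) \<i>)))" for u
    unfolding v_def lform_sum_left by (rule sum.cong[OF HOL.refl lform_commute])
  \<comment> \<open>The product of any two orbit vectors is the cosh of a distance, hence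
    positive.\<close>
  have "lform v v = (\<Sum>k<n. \<Sum>j<n. cosh (hdist ((f ^^ k) \<i>) ((f ^^ j) \<i>)))"
    unfolding expand[of v] expand[of "hyp_vec _"] lform_hyp_vec[OF pos pos] ..
  also have "\<dots> > 0" using n by (intro sum_pos) auto
  finally have "lform v v > 0" .
  moreover have "v $ 3 > 0"
    unfolding v_def sum_component using n pos by (intro sum_pos) auto
  ultimately obtain w c where w: "Im w > 0" "c > 0" "v = c *\<^sub>R hyp_vec w"
    using timelike_normalize by blast
  then have "c *\<^sub>R hyp_vec (f w) = c *\<^sub>R hyp_vec w"
    using inv by (simp add: matrix_vector_mult_scaleR isom_matrix_hyp_vec[OF f])
  then have "f w = w"
    using w hyp_vec_inj[OF isometry_maps(1)[OF f w(1)] w(1)] by simp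
  then show ?thesis using w by blast
qed

section \<open>Orientation\<close>

lemma open_upper_half_plane: "open upper_half_plane"
  unfolding upper_half_plane_def by (rule open_halfspace_Im_gt)

text \<open>The vector of f(w) depends linearly on that of w, and f(w) is recovered from its last
  two entries, so f is a differentiable function of Re w and Im w. Needed for inverses: a derivative
  of f does not by itself give one of its inverse.\<close>

lemma isometry_differentiable:
  assumes f: "f \<in> hyp_isometries" and z: "Im z > 0"
  shows "f differentiable (at z)"
proof -
  define c where "c i w = (isom_matrix f *v hyp_vec w) $ i" for i w
  have ReIm: "Re differentiable (at z)" "Im differentiable (at z)"
    by (auto intro: bounded_linear_imp_differentiable bounded_linear_Re bounded_linear_Im)
  have c: "c i differentiable (at z)" for i
    unfolding c_def matrix_vector_mult_def
    using z by (auto simp: sum_3 power2_eq_square intro!: derivative_intros differentiable_add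
        differentiable_mult differentiable_divide ReIm)
  have c3: "c 3 z > 0" unfolding c_def using z
    by (simp add: isom_matrix_hyp_vec[OF f] isometry_maps(1)[OF f])
  have of_real: "(\<lambda>w. complex_of_real (h w)) differentiable (at z)" if "h differentiable (at z)" for h
    using differentiable_compose[OF bounded_linear_imp_differentiable[OF bounded_linear_of_real] that]
    by (simp add: o_def)
  have "(\<lambda>w. complex_of_real (c 2 w / c 3 w) + \<i> * complex_of_real (1 / c 3 w)) differentiable (at z)"
    using c3 by (intro differentiable_add differentiable_mult of_real differentiable_divide c differentiable_const) auto
  moreover have "complex_of_real (c 2 w / c 3 w) + \<i> * complex_of_real (1 / c 3 w) = f w"
    if "w \<in> upper_half_plane" for w
    using that isometry_maps(1)[OF f, of w]
    by (simp add: c_def upper_half_plane_def isom_matrix_hyp_vec[OF f] complex_eq_iff)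
  ultimately show ?thesis
    unfolding differentiable_def
    using has_derivative_transform_within_open[OF _ open_upper_half_plane] z
    by (metis (mono_tags, lifting) mem_Collect_eq upper_half_plane_def)
qed

lemma jacobian_det_compose:
  assumes "linear D" "linear E"
  shows "jacobian_det (D \<circ> E) = jacobian_det D * jacobian_det E"
proof -
  have D: "D w = Re w *\<^sub>R D 1 + Im w *\<^sub>R D \<i>" for w
  proof -
    have "Re w *\<^sub>R 1 + Im w *\<^sub>R \<i> = w" by (simp add: complex_eq_iff)
    then have "D w = D (Re w *\<^sub>R 1 + Im w *\<^sub>R \<i>)" by simp
    then show ?thesis by (simp only: linear_add[OF assms(1)] linear_scale[OF assms(1)])
  qed
  show ?thesis
    unfolding jacobian_det_def o_def D[of "E 1"] D[of "E \<i>"] by (simp add: algebra_simps)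
qed

text \<open>Carrying the sign as a factor turns the four cases of a composition into one: signs
  multiply.\<close>

definition orientation_sign :: "real \<Rightarrow> (complex \<Rightarrow> complex) \<Rightarrow> bool" where
  "orientation_sign s f \<longleftrightarrow>
     (\<forall>z\<in>upper_half_plane. \<exists>D. (f has_derivative D) (at z) \<and> s * jacobian_det D > 0)"

lemma orientation_preserving_sign: "orientation_preserving f \<longleftrightarrow> orientation_sign 1 f"
  and orientation_reversing_sign: "orientation_reversing f \<longleftrightarrow> orientation_sign (-1) f"
  by (simp_all add: orientation_preserving_def orientation_reversing_def orientation_sign_def)

lemma orientation_sign_compose:
  assumes "orientation_sign s f" "orientation_sign t g"
    and g: "\<And>z. z \<in> upper_half_plane \<Longrightarrow> g z \<in> upper_half_plane"
    and h: "\<And>z. z \<in> upper_half_plane \<Longrightarrow> h z = f (g z)"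
  shows "orientation_sign (s * t) h"
  unfolding orientation_sign_def
proof
  fix z assume z: "z \<in> upper_half_plane"
  obtain E where E: "(g has_derivative E) (at z)" "t * jacobian_det E > 0"
    using assms(2) z unfolding orientation_sign_def by blast
  obtain D where D: "(f has_derivative D) (at (g z))" "s * jacobian_det D > 0"
    using assms(1) g[OF z] unfolding orientation_sign_def by blast
  have "(f \<circ> g has_derivative D \<circ> E) (at z)" by (rule diff_chain_at[OF E(1) D(1)])
  then have "(h has_derivative D \<circ> E) (at z)"
    by (rule has_derivative_transform_within_open[OF _ open_upper_half_plane z]) (simp add: h)
  moreover have "jacobian_det (D \<circ> E) = jacobian_det D * jacobian_det E"
    using D E by (intro jacobian_det_compose has_derivative_linear)
  then have "s * t * jacobian_det (D \<circ> E) > 0"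
    using mult_pos_pos[OF D(2) E(2)] by (simp add: mult_ac)
  ultimately show "\<exists>D. (h has_derivative D) (at z) \<and> s * t * jacobian_det D > 0" by blast
qed

text \<open>By the chain rule the two Jacobian determinants have product 1, so they have the same
  sign.\<close>

lemma orientation_sign_inverse:
  assumes f: "f \<in> hyp_isometries" and g: "g \<in> hyp_isometries"
    and inv: "\<And>z. z \<in> upper_half_plane \<Longrightarrow> f (g z) = z" and sgn: "orientation_sign s f"
  shows "orientation_sign s g"
  unfolding orientation_sign_def
proof
  fix z assume z: "z \<in> upper_half_plane"
  then have gz: "g z \<in> upper_half_plane"
    using isometry_maps(1)[OF g] by (simp add: upper_half_plane_def)
  obtain E where E: "(g has_derivative E) (at z)"
    using isometry_differentiable[OF g, of z] z by (auto simp: upper_half_plane_def differentiable_def)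
  obtain D where D: "(f has_derivative D) (at (g z))" "s * jacobian_det D > 0"
    using sgn gz unfolding orientation_sign_def by blast
  have "(f \<circ> g has_derivative D \<circ> E) (at z)" by (rule diff_chain_at[OF E D(1)])
  then have "((\<lambda>z. z) has_derivative D \<circ> E) (at z)"
    by (rule has_derivative_transform_within_open[OF _ open_upper_half_plane z]) (simp add: inv)
  then have "D \<circ> E = (\<lambda>z. z)" using has_derivative_ident has_derivative_unique by blast
  moreover have "jacobian_det (D \<circ> E) = jacobian_det D * jacobian_det E"
    using D E by (intro jacobian_det_compose has_derivative_linear)
  ultimately have "jacobian_det D * jacobian_det E = 1" by (simp add: jacobian_det_def)
  moreover have "(s * jacobian_det D) * (s * jacobian_det E) = s * s * (jacobian_det D * jacobian_det E)"
    by (simp add: mult_ac)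
  ultimately have "(s * jacobian_det D) * (s * jacobian_det E) = s * s" by simp
  then have "(s * jacobian_det D) * (s * jacobian_det E) \<ge> 0" by (simp only: zero_le_square)
  then have "s * jacobian_det E \<ge> 0" using D(2) by (simp add: zero_le_mult_iff)
  moreover have "s \<noteq> 0" "jacobian_det E \<noteq> 0"
    using D(2) \<open>jacobian_det D * jacobian_det E = 1\<close> by auto
  ultimately have "s * jacobian_det E > 0" by (simp add: less_le)
  then show "\<exists>D. (g has_derivative D) (at z) \<and> s * jacobian_det D > 0" using E by blast
qed

section \<open>The group of isometries\<close>

lemma isometry_closed: "f \<in> hyp_isometries \<Longrightarrow> z \<in> upper_half_plane \<Longrightarrow> f z \<in> upper_half_plane"
  using isometry_maps(1) by (simp add: upper_half_plane_def)

lemma isometry_hdist: "f \<in> hyp_isometries \<Longrightarrow> z \<in> upper_half_plane \<Longrightarrow> w \<in> upper_half_plane \<Longrightarrow>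
    hdist (f z) (f w) = hdist z w"
  using isometry_maps(2) by (simp add: upper_half_plane_def)

lemma isometry_eqI:
  assumes "f \<in> hyp_isometries" "g \<in> hyp_isometries" "\<And>z. z \<in> upper_half_plane \<Longrightarrow> f z = g z"
  shows "f = g"
  using assms Bij_imp_extensional by (intro extensionalityI[of f upper_half_plane]) (auto simp: hyp_isometries_def)

lemma carrier_isom_group [simp]: "carrier isom_group = hyp_isometries"
  by (simp add: isom_group_def)

interpretation isom: group isom_group by (rule group_isom_group)

lemma isom_one_apply: "z \<in> upper_half_plane \<Longrightarrow> \<one>\<^bsub>isom_group\<^esub> z = z"
  by (simp add: isom_group_def BijGroup_def)

lemma isom_mult_apply:
  assumes "f \<in> hyp_isometries" "g \<in> hyp_isometries" "z \<in> upper_half_plane"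
  shows "(f \<otimes>\<^bsub>isom_group\<^esub> g) z = f (g z)"
  using assms by (simp add: isom_group_def BijGroup_def hyp_isometries_def compose_eq)

lemma isom_inv_apply:
  assumes f: "f \<in> hyp_isometries" and z: "z \<in> upper_half_plane"
  shows "f ((inv\<^bsub>isom_group\<^esub> f) z) = z" "(inv\<^bsub>isom_group\<^esub> f) (f z) = z"
  using isom.inv_closed[of f] isom.r_inv[of f] isom.l_inv[of f] f z
    isom_mult_apply[of f "inv\<^bsub>isom_group\<^esub> f" z] isom_mult_apply[of "inv\<^bsub>isom_group\<^esub> f" f z]
  by (simp_all add: isom_one_apply)

lemma i_in_upper_half_plane [simp]: "\<i> \<in> upper_half_plane"
  by (simp add: upper_half_plane_def)

section \<open>Discreteness and cocompactness\<close>

text \<open>A closed hyperbolic ball about i is bounded and stays away from the real axis, so it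
  lies in a Euclidean compact subset of the half-plane. Hyperbolic balls are open in the Euclidean
  sense, and a finite subcover supplies \<open>F\<close>.\<close>

lemma hdist_ball_totally_bounded:
  assumes "\<epsilon> > 0"
  shows "\<exists>F. finite F \<and> F \<subseteq> upper_half_plane \<and>
    (\<forall>z\<in>upper_half_plane. hdist z \<i> \<le> C \<longrightarrow> (\<exists>w\<in>F. hdist w z < \<epsilon>))"
proof -
  define M where "M = cosh C"
  have M: "M \<ge> 1" by (simp add: M_def cosh_real_ge_1)
  \<comment> \<open>From cosh d(z, i) = (|z|^2 + 1) / (2 Im z) \<le> M follow |z|^2 \<le> 2 M |z|
    and 1 \<le> 2 M Im z, which give the two bounds.\<close>
  define K where "K = {z. Im z \<ge> 1 / (2 * M)} \<inter> cball 0 (2 * M)"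
  have "compact K"
    unfolding K_def by (intro closed_Int_compact compact_cball closed_halfspace_Im_ge)
  have KH: "K \<subseteq> upper_half_plane"
  proof
    fix z assume "z \<in> K"
    then have "Im z \<ge> 1 / (2 * M)" by (simp add: K_def)
    moreover have "1 / (2 * M) > 0" using M by (intro divide_pos_pos) auto
    ultimately have "Im z > 0" by linarith
    then show "z \<in> upper_half_plane" by (simp add: upper_half_plane_def)
  qed
  define U where "U w = {z \<in> upper_half_plane. hdist w z < \<epsilon>}" for w
  have "open (U w)" if "w \<in> upper_half_plane" for w
  proof -
    have "continuous_on upper_half_plane (\<lambda>z. cmod (w - z) / (2 * sqrt (\<bar>Im w\<bar> * \<bar>Im z\<bar>)))"
      using that by (intro continuous_intros) (auto simp: upper_half_plane_def)
    then have "continuous_on upper_half_plane (hdist w)"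
      unfolding hdist_def
      by (rule continuous_on_mult_left[OF continuous_on_compose2[OF continuous_on_arsinh[of UNIV] _ subset_UNIV]])
    then have "open (hdist w -` {..<\<epsilon>} \<inter> upper_half_plane)"
      unfolding continuous_on_open_vimage[OF open_upper_half_plane] by simp
    also have "hdist w -` {..<\<epsilon>} \<inter> upper_half_plane = U w" by (auto simp: U_def)
    finally show ?thesis .
  qed
  then have "open (U w)" if "w \<in> K" for w using that KH by blast
  moreover have "K \<subseteq> (\<Union>w\<in>K. U w)"
    using KH assms by (auto simp: U_def hdist_def)
  ultimately obtain F where F: "F \<subseteq> K" "finite F" "K \<subseteq> (\<Union>w\<in>F. U w)"
    by (rule compactE_image[OF \<open>compact K\<close>])
  have "\<exists>w\<in>F. hdist w z < \<epsilon>" if z: "z \<in> upper_half_plane" and C: "hdist z \<i> \<le> C" for z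
  proof -
    have pos: "Im z > 0" using z by (simp add: upper_half_plane_def)
    have "((Re z)\<^sup>2 + (Im z)\<^sup>2 + 1) / (2 * Im z) = cosh (hdist z \<i>)"
      using lform_hyp_vec[of z \<i>] pos by (simp add: lform_def add_divide_distrib)
    also have "\<dots> \<le> M" unfolding M_def using C order_trans[OF hyp.nonneg C]
      by (subst cosh_real_nonneg_le_iff) auto
    finally have "(cmod z)\<^sup>2 + 1 \<le> 2 * M * Im z"
      using pos by (simp add: cmod_power2 field_simps)
    moreover from this have "1 \<le> 2 * M * Im z" using zero_le_power2[of "cmod z"] by linarith
    moreover have "2 * M * Im z \<le> 2 * M * cmod z"
      using M abs_Im_le_cmod[of z] by (intro mult_left_mono) auto
    ultimately have "cmod z * cmod z \<le> 2 * M * cmod z" "1 \<le> 2 * M * Im z"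
      by (auto simp: power2_eq_square)
    moreover have "cmod z > 0" using pos by auto
    ultimately have "cmod z \<le> 2 * M" "1 / (2 * M) \<le> Im z"
      using M by (auto simp: field_simps)
    then have "z \<in> K" by (simp add: K_def)
    then show ?thesis using F by (auto simp: U_def)
  qed
  then show ?thesis using F KH by blast
qed

text \<open>Radii that depend on the centre are what a Lebesgue number argument needs; a constant
  radius gives a finite net.\<close>

lemma compactin_hyp_net:
  assumes K: "compactin hyp.mtopology K" and r: "\<And>x. x \<in> K \<Longrightarrow> r x > 0"
  shows "\<exists>F. finite F \<and> F \<subseteq> K \<and> (\<forall>z\<in>K. \<exists>x\<in>F. hdist x z < r x)"
proof -
  have KH: "K \<subseteq> upper_half_plane" using compactin_subset_topspace[OF K] by simp
  have "\<forall>U\<in>(\<lambda>x. hyp.mball x (r x)) ` K. openin hyp.mtopology U" by auto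
  moreover have "K \<subseteq> \<Union>((\<lambda>x. hyp.mball x (r x)) ` K)" using KH r by auto
  ultimately obtain \<F> where \<F>: "finite \<F>" "\<F> \<subseteq> (\<lambda>x. hyp.mball x (r x)) ` K" "K \<subseteq> \<Union>\<F>"
    using K unfolding compactin_def by meson
  then obtain F where F: "F \<subseteq> K" "finite F" "\<F> = (\<lambda>x. hyp.mball x (r x)) ` F"
    using finite_subset_image by metis
  then show ?thesis using \<F> by (intro exI[of _ F]) (auto simp: hyp.in_mball subset_iff)
qed

text \<open>A subbasic neighbourhood of the identity asks that a compact K be sent into an open U,
  and K itself lies in U. By compactness there is room of some \<open>\<epsilon>\<close> around K,
  as for a Lebesgue number. An intersection joins the compact sets and takes the smaller
  bound.\<close>

lemma isom_topology_one_neighbourhood: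
  assumes "openin isom_topology V" "\<one>\<^bsub>isom_group\<^esub> \<in> V"
  shows "\<exists>K \<epsilon>. compactin hyp.mtopology K \<and> \<epsilon> > 0 \<and>
    (\<forall>f\<in>hyp_isometries. (\<forall>z\<in>K. hdist z (f z) < \<epsilon>) \<longrightarrow> f \<in> V)"
proof -
  let ?B = "{{f \<in> hyp_isometries. f ` K \<subseteq> U} | K U. compactin hyp.mtopology K \<and> openin hyp.mtopology U}"
  have "generate_topology_on ?B V"
    using assms(1) unfolding isom_topology_def by (rule openin_topology_generated_by)
  then show ?thesis using assms(2)
  proof (induction rule: generate_topology_on.induct)
    case Empty
    then show ?case by simp
  next
    case (Int a b)
    then have "\<one>\<^bsub>isom_group\<^esub> \<in> a" "\<one>\<^bsub>isom_group\<^esub> \<in> b" by blast+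
    with Int.IH obtain K \<epsilon> L \<delta> where
      *: "compactin hyp.mtopology K" "\<epsilon> > 0"
        "\<forall>f\<in>hyp_isometries. (\<forall>z\<in>K. hdist z (f z) < \<epsilon>) \<longrightarrow> f \<in> a"
        "compactin hyp.mtopology L" "\<delta> > 0"
        "\<forall>f\<in>hyp_isometries. (\<forall>z\<in>L. hdist z (f z) < \<delta>) \<longrightarrow> f \<in> b"
      by blast
    show ?case
    proof (intro exI conjI ballI impI)
      show "compactin hyp.mtopology (K \<union> L)" "min \<epsilon> \<delta> > 0" using * by (auto intro: compactin_Un)
      fix f assume "f \<in> hyp_isometries" "\<forall>z\<in>K \<union> L. hdist z (f z) < min \<epsilon> \<delta>"
      then show "f \<in> a \<inter> b" using * by simp
    qed
  next
    case (UN \<K>)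
    then obtain k where k: "k \<in> \<K>" "\<one>\<^bsub>isom_group\<^esub> \<in> k" by blast
    show ?case using UN.IH[OF k] k(1) by blast
  next
    case (Basis s)
    then obtain K U where s: "s = {f \<in> hyp_isometries. f ` K \<subseteq> U}"
      and K: "compactin hyp.mtopology K" and U: "openin hyp.mtopology U" by blast
    have KH: "K \<subseteq> upper_half_plane" using compactin_subset_topspace[OF K] by simp
    have "K \<subseteq> U"
    proof
      fix z assume "z \<in> K"
      then have "\<one>\<^bsub>isom_group\<^esub> z \<in> U" using Basis.prems s by blast
      then show "z \<in> U" using \<open>z \<in> K\<close> KH isom_one_apply by auto
    qed
    \<comment> \<open>Twice the radius: one \<open>r\<close> for the distance from x to z, one for
      the displacement of z.\<close>
    have "\<exists>r. r > 0 \<and> hyp.mball x (2 * r) \<subseteq> U" if x: "x \<in> K" for x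
    proof -
      obtain r where "r > 0" "hyp.mball x r \<subseteq> U"
        using U \<open>K \<subseteq> U\<close> x unfolding hyp.openin_mtopology by blast
      then show ?thesis by (intro exI[of _ "r / 2"]) auto
    qed
    then have "\<forall>x\<in>K. \<exists>r. r > 0 \<and> hyp.mball x (2 * r) \<subseteq> U" by blast
    from bchoice[OF this]
    obtain r where r: "\<And>x. x \<in> K \<Longrightarrow> r x > 0" "\<And>x. x \<in> K \<Longrightarrow> hyp.mball x (2 * r x) \<subseteq> U"
      by blast
    have "\<exists>F. finite F \<and> F \<subseteq> K \<and> (\<forall>z\<in>K. \<exists>x\<in>F. hdist x z < r x)"
      by (rule compactin_hyp_net[OF K]) (rule r(1))
    then obtain F where F: "finite F" "F \<subseteq> K" "\<And>z. z \<in> K \<Longrightarrow> \<exists>x\<in>F. hdist x z < r x"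
      by blast
    \<comment> \<open>The 1 keeps the minimum defined when K, and with it F, is empty.\<close>
    define \<epsilon> where "\<epsilon> = Min (insert 1 (r ` F))"
    have pos: "e > 0" if "e \<in> insert 1 (r ` F)" for e
      using that
    proof (rule insertE)
      assume "e \<in> r ` F"
      then show ?thesis using F(2) r(1) by blast
    qed simp
    have fin: "finite (insert 1 (r ` F))" using F(1) by simp
    have \<epsilon>: "\<epsilon> > 0" "\<And>x. x \<in> F \<Longrightarrow> \<epsilon> \<le> r x"
      unfolding \<epsilon>_def by (rule pos[OF Min_in[OF fin]], simp) (rule Min_le[OF fin], simp)
    have "f \<in> s" if f: "f \<in> hyp_isometries" and close: "\<forall>z\<in>K. hdist z (f z) < \<epsilon>" for f
    proof -
      have "f z \<in> U" if z: "z \<in> K" for z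
      proof -
        obtain x where x: "x \<in> F" "hdist x z < r x" using F(3)[OF z] by blast
        have H: "x \<in> upper_half_plane" "z \<in> upper_half_plane" "f z \<in> upper_half_plane"
          using x F z KH isometry_closed[OF f] by auto
        have "hdist x (f z) < 2 * r x"
          using hyp.triangle[OF H] x close z \<epsilon>(2)[OF x(1)] by force
        then have "f z \<in> hyp.mball x (2 * r x)" using H by simp
        then show ?thesis using r(2) x F by blast
      qed
      then show ?thesis using f s by auto
    qed
    then show ?case using K \<epsilon> by blast
  qed
qed

lemma NEC_group_isometry: "NEC_group \<Gamma> \<Longrightarrow> f \<in> \<Gamma> \<Longrightarrow> f \<in> hyp_isometries"
  unfolding NEC_group_def using subgroup.mem_carrier[of \<Gamma> isom_group] by simp

lemma NEC_group_discrete: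
  assumes \<Gamma>: "NEC_group \<Gamma>"
  shows "\<exists>K \<epsilon>. compactin hyp.mtopology K \<and> \<epsilon> > 0 \<and>
    (\<forall>f\<in>\<Gamma>. (\<forall>z\<in>K. hdist z (f z) < \<epsilon>) \<longrightarrow> f = \<one>\<^bsub>isom_group\<^esub>)"
proof -
  have one: "\<one>\<^bsub>isom_group\<^esub> \<in> \<Gamma>" using \<Gamma> by (simp add: NEC_group_def subgroup.one_closed)
  have "openin (subtopology isom_topology \<Gamma>) {\<one>\<^bsub>isom_group\<^esub>}"
    using \<Gamma> one by (simp add: NEC_group_def)
  then obtain V where V: "openin isom_topology V" "{\<one>\<^bsub>isom_group\<^esub>} = V \<inter> \<Gamma>"
    unfolding openin_subtopology by blast
  obtain K \<epsilon> where K: "compactin hyp.mtopology K" "\<epsilon> > 0"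
    "\<And>f. f \<in> hyp_isometries \<Longrightarrow> \<forall>z\<in>K. hdist z (f z) < \<epsilon> \<Longrightarrow> f \<in> V"
    using isom_topology_one_neighbourhood[OF V(1)] V(2) by blast
  have "f = \<one>\<^bsub>isom_group\<^esub>" if "f \<in> \<Gamma>" "\<forall>z\<in>K. hdist z (f z) < \<epsilon>" for f
    using K(3)[OF NEC_group_isometry[OF \<Gamma> that(1)] that(2)] that(1) V(2) by blast
  then show ?thesis using K(1,2) by blast
qed

text \<open>Each f is coded by approximations in a finite set F to the images of a finite net X of
  K. If f and g have the same code, four distances below \<open>\<epsilon> / 4\<close> separate f z
  from g z for every z in K, so \<open>g\<^sup>-\<^sup>1 f\<close> moves K by less than
  \<open>\<epsilon>\<close> and is the identity.\<close>

lemma NEC_group_finite_displacement: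
  assumes \<Gamma>: "NEC_group \<Gamma>"
  shows "finite {f \<in> \<Gamma>. hdist (f \<i>) \<i> \<le> C}"
proof -
  let ?H = upper_half_plane and ?T = "{f \<in> \<Gamma>. hdist (f \<i>) \<i> \<le> C}"
  have sub: "subgroup \<Gamma> isom_group" using \<Gamma> by (simp add: NEC_group_def)
  obtain K \<epsilon> where K: "compactin hyp.mtopology K" and \<epsilon>: "\<epsilon> > 0"
    and disc: "\<And>f. f \<in> \<Gamma> \<Longrightarrow> \<forall>z\<in>K. hdist z (f z) < \<epsilon> \<Longrightarrow> f = \<one>\<^bsub>isom_group\<^esub>"
    using NEC_group_discrete[OF \<Gamma>] by blast
  have KH: "K \<subseteq> ?H" using compactin_subset_topspace[OF K] by simp
  obtain X where X: "finite X" "X \<subseteq> K" "\<And>z. z \<in> K \<Longrightarrow> \<exists>x\<in>X. hdist x z < \<epsilon> / 4"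
    using compactin_hyp_net[OF K, of "\<lambda>_. \<epsilon> / 4"] \<epsilon> by auto
  \<comment> \<open>d(f x, i) \<le> d(x, i) + d(f i, i); the sum over X stands for a maximum of the
    d(x, i) and also covers empty X.\<close>
  define C' where "C' = C + (\<Sum>x\<in>X. hdist x \<i>)"
  obtain F where F: "finite F" "F \<subseteq> ?H"
    "\<And>z. z \<in> ?H \<Longrightarrow> hdist z \<i> \<le> C' \<Longrightarrow> \<exists>w\<in>F. hdist w z < \<epsilon> / 4"
    using hdist_ball_totally_bounded[of "\<epsilon> / 4" C'] \<epsilon> by auto
  have near: "\<exists>w\<in>F. hdist w (f x) < \<epsilon> / 4" if f: "f \<in> ?T" and x: "x \<in> X" for f x
  proof (rule F(3))
    have fi: "f \<in> hyp_isometries" using f NEC_group_isometry[OF \<Gamma>] by blast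
    have xH: "x \<in> ?H" using x X KH by blast
    show "f x \<in> ?H" by (rule isometry_closed[OF fi xH])
    have "hdist (f x) \<i> \<le> hdist (f x) (f \<i>) + hdist (f \<i>) \<i>"
      by (intro hyp.triangle isometry_closed[OF fi] xH i_in_upper_half_plane)
    also have "\<dots> \<le> hdist x \<i> + C" using f isometry_hdist[OF fi xH] by simp
    also have "hdist x \<i> \<le> (\<Sum>x\<in>X. hdist x \<i>)"
      using X x hyp.nonneg by (intro member_le_sum) auto
    finally show "hdist (f x) \<i> \<le> C'" by (simp add: C'_def)
  qed
  define w where "w f x = (SOME w. w \<in> F \<and> hdist w (f x) < \<epsilon> / 4)" for f and x :: complex
  have w: "w f x \<in> F \<and> hdist (w f x) (f x) < \<epsilon> / 4" if "f \<in> ?T" "x \<in> X" for f x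
  proof -
    have "\<exists>v. v \<in> F \<and> hdist v (f x) < \<epsilon> / 4" using near[OF that] by (simp only: Bex_def)
    then show ?thesis unfolding w_def by (rule someI_ex)
  qed
  let ?code = "\<lambda>f. restrict (w f) X"
  have "?code ` ?T \<subseteq> X \<rightarrow>\<^sub>E F" using w by (intro image_subsetI restrict_PiE) auto
  moreover have "finite (X \<rightarrow>\<^sub>E F)" using X F by (intro finite_PiE) auto
  ultimately have "finite (?code ` ?T)" by (rule finite_subset)
  moreover have "inj_on ?code ?T"
  proof (rule inj_onI)
    fix f g assume f: "f \<in> ?T" and g: "g \<in> ?T" and eq: "?code f = ?code g"
    have fi: "f \<in> hyp_isometries" and gi: "g \<in> hyp_isometries"
      using f g NEC_group_isometry[OF \<Gamma>] by blast+
    have close: "hdist (f z) (g z) < \<epsilon>" if z: "z \<in> K" for z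
    proof -
      obtain x where x: "x \<in> X" "hdist x z < \<epsilon> / 4" using X(3)[OF z] by blast
      define y where "y = w f x"
      have y: "y \<in> F" "hdist y (f x) < \<epsilon> / 4" "hdist y (g x) < \<epsilon> / 4"
        using w[OF f x(1)] w[OF g x(1)] fun_cong[OF eq, of x] x(1) by (auto simp: y_def)
      have H: "x \<in> ?H" "z \<in> ?H" "y \<in> ?H" using x X z y F KH by auto
      note H' = isometry_closed[OF fi H(1)] isometry_closed[OF fi H(2)]
        isometry_closed[OF gi H(1)] isometry_closed[OF gi H(2)]
      have "hdist (f z) (g z) \<le> hdist (f z) (f x) + hdist (f x) (g z)"
        by (intro hyp.triangle H')
      also have "hdist (f x) (g z) \<le> hdist (f x) y + hdist y (g z)"
        by (intro hyp.triangle H' H)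
      also have "hdist y (g z) \<le> hdist y (g x) + hdist (g x) (g z)"
        by (intro hyp.triangle H' H)
      finally show ?thesis
        using x y isometry_hdist[OF fi H(2,1)] isometry_hdist[OF gi H(1,2)]
          hyp.commute[of z x] hyp.commute[of "f x" y] by simp
    qed
    define h where "h = inv\<^bsub>isom_group\<^esub> g \<otimes>\<^bsub>isom_group\<^esub> f"
    have h\<Gamma>: "h \<in> \<Gamma>" using f g sub by (simp add: h_def subgroup.m_closed subgroup.m_inv_closed)
    have "hdist z (h z) < \<epsilon>" if z: "z \<in> K" for z
    proof -
      have zH: "z \<in> ?H" using z KH by blast
      have hi: "h \<in> hyp_isometries" using h\<Gamma> NEC_group_isometry[OF \<Gamma>] by blast
      have "g (h z) = f z"
        using isom_inv_apply(1)[OF gi isometry_closed[OF fi zH]] isom.inv_closed[of g] gi fi zH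
        by (simp add: h_def isom_mult_apply)
      then have "hdist (h z) z = hdist (f z) (g z)"
        using isometry_hdist[OF gi isometry_closed[OF hi zH] zH] by simp
      then show ?thesis using close[OF z] hyp.commute[of z "h z"] by simp
    qed
    then have "h = \<one>\<^bsub>isom_group\<^esub>" using disc[OF h\<Gamma>] by blast
    then show "f = g"
      using fi gi isom.one_closed isom.inv_solve_left'[of "\<one>\<^bsub>isom_group\<^esub>" g f] unfolding h_def by simp
  qed
  ultimately show ?thesis by (rule finite_imageD)
qed

text \<open>The orbits that meet the open ball of radius n about i form an open set of the orbit
  space, and these sets cover it; a finite subcover bounds the distance from i to every
  orbit.\<close>

lemma NEC_group_cocompact:
  assumes \<Gamma>: "NEC_group \<Gamma>"
  shows "\<exists>C. \<forall>z\<in>upper_half_plane. \<exists>f\<in>\<Gamma>. hdist (f z) \<i> \<le> C"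
proof -
  let ?H = upper_half_plane and ?G = "isom_subgroup \<Gamma>"
  let ?O = "orbits ?G ?H (\<lambda>f. f)"
  have sub: "subgroup \<Gamma> isom_group" using \<Gamma> by (simp add: NEC_group_def)
  have iso: "f \<in> hyp_isometries" if "f \<in> \<Gamma>" for f using NEC_group_isometry[OF \<Gamma> that] .
  have inv: "inv\<^bsub>isom_group\<^esub> f \<in> \<Gamma>" if "f \<in> \<Gamma>" for f
    using subgroup.m_inv_closed[OF sub that] .
  define U where "U n = {P \<in> ?O. \<exists>w\<in>P. hdist w \<i> < real n}" for n
  have orb: "P \<in> ?O \<longleftrightarrow> (\<exists>z\<in>?H. P = (\<lambda>f. f z) ` \<Gamma>)" for P
    by (auto simp: orbits_def orbit_def)
  \<comment> \<open>Openness in the orbit space is openness of the union, which consists of the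
    balls of radius n about the points of the orbit of i.\<close>
  have union: "\<Union>(U n) = (\<Union>f\<in>\<Gamma>. hyp.mball ((inv\<^bsub>isom_group\<^esub> f) \<i>) (real n))" for n
  proof (intro equalityI subsetI)
    fix y assume "y \<in> \<Union>(U n)"
    then obtain z f g where *: "z \<in> ?H" "f \<in> \<Gamma>" "g \<in> \<Gamma>" "y = g z" "hdist (f z) \<i> < real n"
      unfolding U_def orb by auto
    define h where "h = f \<otimes>\<^bsub>isom_group\<^esub> inv\<^bsub>isom_group\<^esub> g"
    have h: "h \<in> \<Gamma>" using * inv by (simp add: h_def subgroup.m_closed[OF sub])
    have y: "y \<in> ?H" using * isometry_closed[OF iso] by simp
    have "h y = f z" using * y inv iso by (simp add: h_def isom_mult_apply isom_inv_apply)
    moreover have "hdist ((inv\<^bsub>isom_group\<^esub> h) \<i>) y = hdist \<i> (h y)"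
      using isometry_hdist[OF iso[OF h] isometry_closed[OF iso[OF inv[OF h]] i_in_upper_half_plane] y]
      by (simp add: isom_inv_apply iso[OF h])
    ultimately have "y \<in> hyp.mball ((inv\<^bsub>isom_group\<^esub> h) \<i>) (real n)"
      using * y isometry_closed[OF iso[OF inv[OF h]], of \<i>] hyp.commute[of \<i> "f z"] by simp
    then show "y \<in> (\<Union>f\<in>\<Gamma>. hyp.mball ((inv\<^bsub>isom_group\<^esub> f) \<i>) (real n))" using h by blast
  next
    fix y assume "y \<in> (\<Union>f\<in>\<Gamma>. hyp.mball ((inv\<^bsub>isom_group\<^esub> f) \<i>) (real n))"
    then obtain f where f: "f \<in> \<Gamma>" "y \<in> ?H" "hdist ((inv\<^bsub>isom_group\<^esub> f) \<i>) y < real n" by auto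
    have "hdist (f y) \<i> < real n"
      using f(3) isometry_hdist[OF iso[OF f(1)] isometry_closed[OF iso[OF inv[OF f(1)]] i_in_upper_half_plane] f(2)]
        hyp.commute[of "f y" \<i>]
      by (simp add: isom_inv_apply iso[OF f(1)])
    then have "(\<lambda>f. f y) ` \<Gamma> \<in> U n" unfolding U_def using f orb by auto
    moreover have "y \<in> (\<lambda>f. f y) ` \<Gamma>"
      using isom_one_apply[OF f(2)] subgroup.one_closed[OF sub] by (metis image_eqI)
    ultimately show "y \<in> \<Union>(U n)" by blast
  qed
  have opn: "openin (orbit_space \<Gamma>) (U n)" for n
    unfolding openin_orbit_space[OF sub] union by (auto simp: U_def intro!: openin_Union)
  have cover: "\<exists>n. P \<in> U n" if P: "P \<in> ?O" for P
  proof -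
    obtain z where z: "z \<in> ?H" "P = (\<lambda>f. f z) ` \<Gamma>" using P orb by blast
    obtain n where "hdist (\<one>\<^bsub>isom_group\<^esub> z) \<i> < real n" using reals_Archimedean2 by blast
    then show ?thesis unfolding U_def using P z subgroup.one_closed[OF sub] by blast
  qed
  have "topspace (orbit_space \<Gamma>) \<subseteq> ?O"
    using openin_topspace[of "orbit_space \<Gamma>"] unfolding openin_orbit_space[OF sub] by blast
  then have "topspace (orbit_space \<Gamma>) \<subseteq> \<Union>(range U)" using cover by blast
  moreover have "compactin (orbit_space \<Gamma>) (topspace (orbit_space \<Gamma>))"
    using \<Gamma> by (simp add: NEC_group_def compact_space_def)
  moreover have "\<forall>V\<in>range U. openin (orbit_space \<Gamma>) V" using opn by blast
  ultimately obtain \<F> where \<F>: "finite \<F>" "\<F> \<subseteq> range U" "topspace (orbit_space \<Gamma>) \<subseteq> \<Union>\<F>"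
    unfolding compactin_def by meson
  then obtain N where N: "finite N" "\<F> = U ` N" using finite_subset_image by metis
  \<comment> \<open>The sum of N bounds each of its elements, even if N is empty.\<close>
  have "\<exists>f\<in>\<Gamma>. hdist (f z) \<i> \<le> real (\<Sum>N)" if z: "z \<in> ?H" for z
  proof -
    have P: "(\<lambda>f. f z) ` \<Gamma> \<in> ?O" using orb z by blast
    then have "(\<lambda>f. f z) ` \<Gamma> \<in> topspace (orbit_space \<Gamma>)"
      using cover opn openin_subset by blast
    then obtain n where n: "n \<in> N" "(\<lambda>f. f z) ` \<Gamma> \<in> U n" using \<F> N by blast
    then obtain f where f: "f \<in> \<Gamma>" "hdist (f z) \<i> < real n" unfolding U_def by auto
    have "n \<le> \<Sum>N" using N n by (intro member_le_sum) auto
    then have "real n \<le> real (\<Sum>N)" by (rule of_nat_mono)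
    then show ?thesis using f by (intro bexI[of _ f]) linarith+
  qed
  then show ?thesis by blast
qed

section \<open>Congruence subgroups\<close>

lemma presents_induct [consumes 3, case_names one mult mult_inv]:
  assumes G: "group G" and pres: "presents S R \<phi> G" and f: "f \<in> carrier G"
    and one: "P \<one>\<^bsub>G\<^esub>"
    and mult: "\<And>s x. s \<in> S \<Longrightarrow> x \<in> carrier G \<Longrightarrow> P x \<Longrightarrow> P (\<phi> s \<otimes>\<^bsub>G\<^esub> x)"
    and mult_inv: "\<And>s x. s \<in> S \<Longrightarrow> x \<in> carrier G \<Longrightarrow> P x \<Longrightarrow> P (inv\<^bsub>G\<^esub> \<phi> s \<otimes>\<^bsub>G\<^esub> x)"
  shows "P f"
proof -
  interpret group G by (rule G)
  have \<phi>: "\<phi> s \<in> carrier G" if "s \<in> S" for s using pres that by (auto simp: presents_def)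
  obtain w where w: "w \<in> words S" "f = word_value G \<phi> w" using pres f by (auto simp: presents_def)
  have "word_value G \<phi> w \<in> carrier G \<and> P (word_value G \<phi> w)"
    using w(1)
  proof (induction w)
    case Nil
    then show ?case using one by (simp add: word_value_def)
  next
    case (Cons a w)
    obtain s b where a: "a = (s, b)" by (cases a)
    have s: "s \<in> S" and "w \<in> words S" using Cons.prems a by (auto simp: words_def)
    then have IH: "word_value G \<phi> w \<in> carrier G" "P (word_value G \<phi> w)" using Cons.IH by auto
    have "word_value G \<phi> (a # w)
        = (if b then \<phi> s else inv\<^bsub>G\<^esub> \<phi> s) \<otimes>\<^bsub>G\<^esub> word_value G \<phi> w"
      by (simp add: word_value_def a)
    then show ?case using mult[OF s IH] mult_inv[OF s IH] \<phi>[OF s] IH by simp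
  qed
  then show ?thesis using w by simp
qed

lemma finite_nec_generators: "finite (nec_generators g \<epsilon> ms nss)"
proof -
  have "{c_gen i j | i j. i < length nss \<and> j \<le> length (nss ! i)}
      = (\<Union>i<length nss. c_gen i ` {..length (nss ! i)})" by auto
  then have "finite {c_gen i j | i j. i < length nss \<and> j \<le> length (nss ! i)}" by simp
  then show ?thesis unfolding nec_generators_def by (cases \<epsilon>) auto
qed

lemma isom_matrix_mult:
  assumes "f \<in> hyp_isometries" "g \<in> hyp_isometries"
  shows "isom_matrix (f \<otimes>\<^bsub>isom_group\<^esub> g) = isom_matrix f ** isom_matrix g"
  using assms isom.m_closed[of f g]
  by (intro isom_matrix_compose) (simp_all add: isom_mult_apply upper_half_plane_def)

lemma isom_matrix_one: "isom_matrix \<one>\<^bsub>isom_group\<^esub> = mat 1"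
  using isom.one_closed by (intro isom_matrix_id) (simp_all add: isom_one_apply upper_half_plane_def)

lemma orientation_sign_mult:
  assumes "f \<in> hyp_isometries" "g \<in> hyp_isometries" "orientation_sign s f" "orientation_sign t g"
  shows "orientation_sign (s * t) (f \<otimes>\<^bsub>isom_group\<^esub> g)"
  using assms(3,4) isometry_closed[OF assms(2)] isom_mult_apply[OF assms(1,2)]
  by (rule orientation_sign_compose)

lemma orientation_sign_inv:
  assumes "f \<in> hyp_isometries" "orientation_sign s f"
  shows "orientation_sign s (inv\<^bsub>isom_group\<^esub> f)"
proof (rule orientation_sign_inverse[OF assms(1) _ isom_inv_apply(1)[OF assms(1)] assms(2)])
  show "inv\<^bsub>isom_group\<^esub> f \<in> hyp_isometries" using isom.inv_closed[of f] assms(1) by simp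
qed

lemma orientation_sign_one: "orientation_sign 1 \<one>\<^bsub>isom_group\<^esub>"
  unfolding orientation_sign_def
proof
  fix z assume z: "z \<in> upper_half_plane"
  have "(\<one>\<^bsub>isom_group\<^esub> has_derivative (\<lambda>z. z)) (at z)"
    by (rule has_derivative_transform_within_open[OF has_derivative_ident open_upper_half_plane z])
      (simp add: isom_one_apply)
  then show "\<exists>D. (\<one>\<^bsub>isom_group\<^esub> has_derivative D) (at z) \<and> 1 * jacobian_det D > 0"
    by (intro exI[of _ "\<lambda>z. z"]) (simp add: jacobian_det_def)
qed

lemma nec_generator_orientation:
  assumes sig: "has_signature \<Gamma> g \<epsilon> ms nss"
  shows "\<exists>\<phi>. presents (nec_generators g \<epsilon> ms nss) (nec_relations g \<epsilon> ms nss) \<phi> (isom_subgroup \<Gamma>) \<and>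
    (\<forall>s\<in>nec_generators g \<epsilon> ms nss. orientation_preserving (\<phi> s) \<or> orientation_reversing (\<phi> s))"
proof -
  obtain \<phi> where \<phi>: "presents (nec_generators g \<epsilon> ms nss) (nec_relations g \<epsilon> ms nss) \<phi> (isom_subgroup \<Gamma>)"
    and gens: "\<forall>i<length ms. elliptic (\<phi> (x_gen i))"
      "\<forall>i<length nss. orientation_preserving (\<phi> (e_gen i))"
      "\<forall>i<length nss. \<forall>j\<le>length (nss ! i). reflection (\<phi> (c_gen i j))"
      "case \<epsilon> of
          Plus \<Rightarrow> \<forall>i<g. orientation_preserving (\<phi> (a_gen i)) \<and> orientation_preserving (\<phi> (b_gen i))
        | Minus \<Rightarrow> \<forall>i<g. glide_reflection (\<phi> (d_gen i))"
    using sig unfolding has_signature_def by blast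
  have "orientation_preserving (\<phi> s) \<or> orientation_reversing (\<phi> s)"
    if "s \<in> nec_generators g \<epsilon> ms nss" for s
    using that gens unfolding nec_generators_def elliptic_def reflection_def glide_reflection_def
    by (cases \<epsilon>) auto
  then show ?thesis using \<phi> by blast
qed

text \<open>Each predicate demands one sign of the Jacobian at all points. The dichotomy is obtained
  from the generators, whose orientation the signature prescribes, because signs multiply along a
  word.\<close>

lemma signature_orientation:
  assumes \<Gamma>: "subgroup \<Gamma> isom_group" and sig: "has_signature \<Gamma> g \<epsilon> ms nss" and f: "f \<in> \<Gamma>"
  shows "orientation_preserving f \<or> orientation_reversing f"
proof -
  let ?S = "nec_generators g \<epsilon> ms nss" and ?G = "isom_subgroup \<Gamma>"
  obtain \<phi> where pres: "presents ?S (nec_relations g \<epsilon> ms nss) \<phi> ?G"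
    and ori: "\<And>s. s \<in> ?S \<Longrightarrow> orientation_preserving (\<phi> s) \<or> orientation_reversing (\<phi> s)"
    using nec_generator_orientation[OF sig] by blast
  have \<phi>: "\<phi> s \<in> \<Gamma>" if "s \<in> ?S" for s using pres that by (auto simp: presents_def)
  have iso: "h \<in> hyp_isometries" if "h \<in> \<Gamma>" for h using subgroup.mem_carrier[OF \<Gamma> that] by simp
  have step: "\<exists>t\<in>{1, -1}. orientation_sign t (h \<otimes>\<^bsub>isom_group\<^esub> x)"
    if h: "h \<in> \<Gamma>" "x \<in> \<Gamma>" "s \<in> {1, -1}" "orientation_sign s h"
      and x: "\<exists>t\<in>{1, -1}. orientation_sign t x" for h x s
  proof -
    obtain t where "t \<in> {1, -1}" "orientation_sign t x" using x by blast
    then have "orientation_sign (s * t) (h \<otimes>\<^bsub>isom_group\<^esub> x)" "s * t \<in> {1, -1}"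
      using h by (auto intro: orientation_sign_mult iso)
    then show ?thesis by blast
  qed
  have gen: "\<exists>t\<in>{1, -1}. orientation_sign t (\<phi> s)" if "s \<in> ?S" for s
    using ori[OF that] by (auto simp: orientation_preserving_sign orientation_reversing_sign)
  have f': "f \<in> carrier ?G" using f by simp
  have "\<exists>t\<in>{1, -1}. orientation_sign t f"
    using isom.subgroup_imp_group[OF \<Gamma>] pres f'
  proof (induction rule: presents_induct)
    case one
    then show ?case using orientation_sign_one by auto
  next
    case (mult s x)
    have x: "x \<in> \<Gamma>" using mult(2) by simp
    obtain t where t: "t \<in> {1, -1}" "orientation_sign t (\<phi> s)" using gen[OF mult(1)] by blast
    show ?case using step[OF \<phi>[OF mult(1)] x t mult(3)] by simp
  next
    case (mult_inv s x)
    have inv: "inv\<^bsub>?G\<^esub> \<phi> s = inv\<^bsub>isom_group\<^esub> \<phi> s"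
      using isom.m_inv_consistent[OF \<Gamma>] \<phi> mult_inv by simp
    obtain t where t: "t \<in> {1, -1}" "orientation_sign t (inv\<^bsub>isom_group\<^esub> \<phi> s)"
      using gen[OF mult_inv(1)] orientation_sign_inv[OF iso[OF \<phi>[OF mult_inv(1)]]] by blast
    have x: "x \<in> \<Gamma>" using mult_inv(2) by simp
    show ?case
      using step[OF subgroup.m_inv_closed[OF \<Gamma> \<phi>[OF mult_inv(1)]] x t mult_inv(3)] by (simp add: inv)
  qed
  then show ?thesis by (auto simp: orientation_preserving_sign orientation_reversing_sign)
qed

text \<open>\<open>E\<close> also takes the entries of the inverse generators, so that sums and
  products suffice to reach all of \<open>\<Gamma>\<close>. The ring is left open in order that A
  may later be chosen to contain further elements.\<close>

lemma signature_finitely_generated_entries: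
  assumes \<Gamma>: "subgroup \<Gamma> isom_group" and sig: "has_signature \<Gamma> g \<epsilon> ms nss"
  shows "\<exists>E. finite E \<and>
    (\<forall>A. subring_set A \<longrightarrow> E \<subseteq> A \<longrightarrow> (\<forall>f\<in>\<Gamma>. \<forall>i j. isom_matrix f $ i $ j \<in> A))"
proof -
  let ?S = "nec_generators g \<epsilon> ms nss" and ?G = "isom_subgroup \<Gamma>"
  obtain \<phi> where pres: "presents ?S (nec_relations g \<epsilon> ms nss) \<phi> ?G"
    using sig unfolding has_signature_def by blast
  have \<phi>: "\<phi> s \<in> \<Gamma>" if "s \<in> ?S" for s using pres that by (auto simp: presents_def)
  have iso: "h \<in> hyp_isometries" if "h \<in> \<Gamma>" for h using subgroup.mem_carrier[OF \<Gamma> that] by simp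
  define X where "X = \<phi> ` ?S \<union> (\<lambda>s. inv\<^bsub>isom_group\<^esub> \<phi> s) ` ?S"
  have X: "X \<subseteq> hyp_isometries"
    using \<phi> iso subgroup.m_inv_closed[OF \<Gamma>] by (auto simp: X_def)
  define E where "E = (\<lambda>(h, i, j). isom_matrix h $ i $ j) ` (X \<times> UNIV)"
  have "finite E" unfolding E_def X_def using finite_nec_generators by auto
  moreover have "isom_matrix f $ i $ j \<in> A" if A: "subring_set A" "E \<subseteq> A" and f: "f \<in> \<Gamma>" for A f i j
  proof -
    have gen: "isom_matrix h $ i $ j \<in> A" if "h \<in> X" for h i j
    proof -
      have "isom_matrix h $ i $ j \<in> E"
        unfolding E_def using that by (intro image_eqI[of _ _ "(h, i, j)"]) auto
      then show ?thesis using A(2) by blast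
    qed
    have step: "\<forall>i j. isom_matrix (h \<otimes>\<^bsub>isom_group\<^esub> x) $ i $ j \<in> A"
      if "h \<in> X" "x \<in> \<Gamma>" "\<forall>i j. isom_matrix x $ i $ j \<in> A" for h x
      using that gen X iso
      by (auto simp: isom_matrix_mult subset_iff matrix_matrix_mult_def
          intro!: subring_sum[OF A(1)] subring_mult[OF A(1)])
    have f': "f \<in> carrier ?G" using f by simp
    have "\<forall>i j. isom_matrix f $ i $ j \<in> A"
      using isom.subgroup_imp_group[OF \<Gamma>] pres f'
    proof (induction rule: presents_induct)
      case one
      then show ?case
        by (auto simp: isom_matrix_one mat_def intro: subring_one[OF A(1)] subring_zero[OF A(1)])
    next
      case (mult s x)
      then show ?case using step[of "\<phi> s" x] by (simp add: X_def)
    next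
      case (mult_inv s x)
      have "inv\<^bsub>?G\<^esub> \<phi> s = inv\<^bsub>isom_group\<^esub> \<phi> s"
        using isom.m_inv_consistent[OF \<Gamma>] \<phi> mult_inv by simp
      then show ?case using step[of "inv\<^bsub>isom_group\<^esub> \<phi> s" x] mult_inv by (simp add: X_def)
    qed
    then show ?thesis by blast
  qed
  ultimately show ?thesis by blast
qed

section \<open>Matrices congruent modulo an ideal\<close>

definition matrix_cong :: "real set \<Rightarrow> real^3^3 \<Rightarrow> real^3^3 \<Rightarrow> bool" where
  "matrix_cong I M N \<longleftrightarrow> (\<forall>i j. M $ i $ j - N $ i $ j \<in> I)"

context
  fixes A I :: "real set"
  assumes A: "subring_set A" and I: "finite_quotient A I"
begin

lemma matrix_cong_trans:
  assumes "matrix_cong I M N" "matrix_cong I N P"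
  shows "matrix_cong I M P"
  unfolding matrix_cong_def
proof (intro allI)
  fix i j
  have "(M $ i $ j - N $ i $ j) + (N $ i $ j - P $ i $ j) \<in> I"
    using assms unfolding matrix_cong_def by (intro ideal_add[OF A I]) auto
  then show "M $ i $ j - P $ i $ j \<in> I" by simp
qed

lemma matrix_cong_mult_left:
  assumes "matrix_cong I M N" "\<And>i j. P $ i $ j \<in> A"
  shows "matrix_cong I (P ** M) (P ** N)"
  using assms unfolding matrix_cong_def matrix_matrix_mult_def
  by (auto simp flip: sum_subtractf right_diff_distrib intro!: ideal_sum[OF A I] ideal_mult[OF A I])

lemma matrix_cong_mult_right:
  assumes "matrix_cong I M N" "\<And>i j. P $ i $ j \<in> A"
  shows "matrix_cong I (M ** P) (N ** P)"
  using assms unfolding matrix_cong_def matrix_matrix_mult_def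
  by (auto simp flip: sum_subtractf left_diff_distrib intro!: ideal_sum[OF A I] ideal_mult_right[OF A I])

end

text \<open>On S, h factors through v. Below, v is the residue data of a group element and h its
  coset.\<close>

lemma finite_image_factor:
  assumes "finite (v ` S)" "\<And>a b. a \<in> S \<Longrightarrow> b \<in> S \<Longrightarrow> v a = v b \<Longrightarrow> h a = h b"
  shows "finite (h ` S)"
proof -
  have "h a = h (inv_into S v (v a))" if "a \<in> S" for a
    using that by (intro assms(2)) (auto intro: inv_into_into simp: f_inv_into_f)
  then have "h ` S \<subseteq> (\<lambda>t. h (inv_into S v t)) ` v ` S" by auto
  then show ?thesis using assms(1) by (meson finite_imageI finite_subset)
qed

definition congruence_subgroup :: "(complex \<Rightarrow> complex) set \<Rightarrow> real set \<Rightarrow> (complex \<Rightarrow> complex) set" where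
  "congruence_subgroup \<Gamma> I =
     {f \<in> \<Gamma>. orientation_preserving f \<and> matrix_cong I (isom_matrix f) (mat 1)}"

context
  fixes A I :: "real set" and \<Gamma> :: "(complex \<Rightarrow> complex) set"
  assumes A: "subring_set A" and I: "finite_quotient A I" and \<Gamma>: "subgroup \<Gamma> isom_group"
    and entries: "\<And>f i j. f \<in> \<Gamma> \<Longrightarrow> isom_matrix f $ i $ j \<in> A"
    and orient: "\<And>f. f \<in> \<Gamma> \<Longrightarrow> orientation_preserving f \<or> orientation_reversing f"
begin

text \<open>The entries of elements of \<open>\<Gamma>\<close> and of their inverses lie in A, so
  congruences may be multiplied by these matrices on either side. A conjugate by x keeps its sign
  because the sign of x occurs twice.\<close>

lemma normal_congruence_subgroup: "congruence_subgroup \<Gamma> I \<lhd> isom_subgroup \<Gamma>"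
proof -
  let ?G = "isom_subgroup \<Gamma>" and ?N = "congruence_subgroup \<Gamma> I"
  interpret G: group ?G by (rule isom.subgroup_imp_group[OF \<Gamma>])
  have iso: "f \<in> hyp_isometries" if "f \<in> \<Gamma>" for f using subgroup.mem_carrier[OF \<Gamma> that] by simp
  have inv: "inv\<^bsub>?G\<^esub> f = inv\<^bsub>isom_group\<^esub> f" if "f \<in> \<Gamma>" for f
    using isom.m_inv_consistent[OF \<Gamma> that] .
  have inv_in: "inv\<^bsub>isom_group\<^esub> f \<in> \<Gamma>" if "f \<in> \<Gamma>" for f
    using subgroup.m_inv_closed[OF \<Gamma> that] .
  have mult_in: "f \<otimes>\<^bsub>isom_group\<^esub> g \<in> \<Gamma>" if "f \<in> \<Gamma>" "g \<in> \<Gamma>" for f g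
    using subgroup.m_closed[OF \<Gamma> that] .
  have memD: "f \<in> \<Gamma>" "orientation_sign 1 f" "matrix_cong I (isom_matrix f) (mat 1)" if "f \<in> ?N" for f
    using that by (auto simp: congruence_subgroup_def orientation_preserving_sign)
  have memI: "f \<in> ?N" if "f \<in> \<Gamma>" "orientation_sign 1 f" "matrix_cong I (isom_matrix f) (mat 1)" for f
    using that by (auto simp: congruence_subgroup_def orientation_preserving_sign)
  have "subgroup ?N ?G"
  proof (rule G.subgroupI)
    show "?N \<subseteq> carrier ?G" using memD(1) by auto
    have "\<one>\<^bsub>isom_group\<^esub> \<in> ?N"
      using subgroup.one_closed[OF \<Gamma>] orientation_sign_one
      by (intro memI) (auto simp: isom_matrix_one matrix_cong_def ideal_zero[OF A I])
    then show "?N \<noteq> {}" by blast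
  next
    fix f assume f: "f \<in> ?N"
    let ?f = "inv\<^bsub>isom_group\<^esub> f"
    note fD = memD[OF f]
    have f': "?f \<in> \<Gamma>" by (rule inv_in[OF fD(1)])
    have "isom_matrix ?f ** isom_matrix f = mat 1"
      using isom_matrix_mult[OF iso[OF f'] iso[OF fD(1)]] isom.l_inv[of f] iso[OF fD(1)]
      by (simp add: isom_matrix_one)
    \<comment> \<open>The congruence of the matrix of f with 1, multiplied by the inverse
      matrix.\<close>
    then have "matrix_cong I (mat 1) (isom_matrix ?f)"
      using matrix_cong_mult_left[OF A I fD(3) entries[OF f']] by simp
    then have "matrix_cong I (isom_matrix ?f) (mat 1)"
      unfolding matrix_cong_def using ideal_uminus[OF A I] by fastforce
    then show "inv\<^bsub>?G\<^esub> f \<in> ?N"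
      using orientation_sign_inv[OF iso[OF fD(1)] fD(2)] f' inv[OF fD(1)] by (simp add: memI)
  next
    fix f g assume f: "f \<in> ?N" and g: "g \<in> ?N"
    note fD = memD[OF f] and gD = memD[OF g]
    have "matrix_cong I (isom_matrix f ** isom_matrix g) (isom_matrix f)"
      using matrix_cong_mult_left[OF A I gD(3) entries[OF fD(1)]] by simp
    then have "matrix_cong I (isom_matrix (f \<otimes>\<^bsub>isom_group\<^esub> g)) (mat 1)"
      using matrix_cong_trans[OF A I _ fD(3)] isom_matrix_mult[OF iso[OF fD(1)] iso[OF gD(1)]] by simp
    moreover have "orientation_sign 1 (f \<otimes>\<^bsub>isom_group\<^esub> g)"
      using orientation_sign_mult[OF iso[OF fD(1)] iso[OF gD(1)] fD(2) gD(2)] by simp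
    ultimately have "f \<otimes>\<^bsub>isom_group\<^esub> g \<in> ?N" using mult_in[OF fD(1) gD(1)] by (intro memI)
    then show "f \<otimes>\<^bsub>?G\<^esub> g \<in> ?N" by simp
  qed
  moreover have "x \<otimes>\<^bsub>?G\<^esub> h \<otimes>\<^bsub>?G\<^esub> inv\<^bsub>?G\<^esub> x \<in> ?N" if x: "x \<in> carrier ?G" and h: "h \<in> ?N" for x h
  proof -
    let ?x = "inv\<^bsub>isom_group\<^esub> x"
    note hD = memD[OF h]
    have x\<Gamma>: "x \<in> \<Gamma>" "?x \<in> \<Gamma>" using x inv_in by auto
    let ?y = "(x \<otimes>\<^bsub>isom_group\<^esub> h) \<otimes>\<^bsub>isom_group\<^esub> ?x"
    have xh: "x \<otimes>\<^bsub>isom_group\<^esub> h \<in> \<Gamma>" by (rule mult_in[OF x\<Gamma>(1) hD(1)])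
    have "isom_matrix x ** isom_matrix ?x = mat 1"
      using isom_matrix_mult[OF iso[OF x\<Gamma>(1)] iso[OF x\<Gamma>(2)]] isom.r_inv[of x] iso[OF x\<Gamma>(1)]
      by (simp add: isom_matrix_one)
    then have "matrix_cong I ((isom_matrix x ** isom_matrix h) ** isom_matrix ?x) (mat 1)"
      using matrix_cong_mult_right[OF A I matrix_cong_mult_left[OF A I hD(3) entries[OF x\<Gamma>(1)]] entries[OF x\<Gamma>(2)]]
      by simp
    then have "matrix_cong I (isom_matrix ?y) (mat 1)"
      by (simp only: isom_matrix_mult[OF iso[OF xh] iso[OF x\<Gamma>(2)]] isom_matrix_mult[OF iso[OF x\<Gamma>(1)] iso[OF hD(1)]])
    moreover obtain s where "orientation_sign s x" "s * s = 1"
      using orient[OF x\<Gamma>(1)] that[of 1] that[of "-1"]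
      unfolding orientation_preserving_sign orientation_reversing_sign by auto
    then have "orientation_sign 1 ?y"
      using orientation_sign_mult[OF iso[OF xh] iso[OF x\<Gamma>(2)]
          orientation_sign_mult[OF iso[OF x\<Gamma>(1)] iso[OF hD(1)] _ hD(2)] orientation_sign_inv[OF iso[OF x\<Gamma>(1)]]]
      by fastforce
    ultimately show ?thesis using mult_in[OF xh x\<Gamma>(2)] inv x\<Gamma> by (simp add: memI)
  qed
  ultimately show ?thesis using G.normal_inv_iff by blast
qed

text \<open>The orientation and the matrix entries rounded by \<open>\<rho>\<close> to congruent
  elements of a finite set take finitely many values. If they agree for a and b, then
  \<open>a b\<^sup>-\<^sup>1\<close> preserves orientation and is congruent to 1.\<close>

lemma finite_rcosets_congruence_subgroup:
  "finite (rcosets\<^bsub>isom_subgroup \<Gamma>\<^esub> congruence_subgroup \<Gamma> I)"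
proof -
  let ?G = "isom_subgroup \<Gamma>" and ?N = "congruence_subgroup \<Gamma> I"
  interpret G: group ?G by (rule isom.subgroup_imp_group[OF \<Gamma>])
  have N: "subgroup ?N ?G" by (rule normal_imp_subgroup[OF normal_congruence_subgroup])
  have iso: "f \<in> hyp_isometries" if "f \<in> \<Gamma>" for f using subgroup.mem_carrier[OF \<Gamma> that] by simp
  obtain F where F: "finite F" "\<And>x. x \<in> A \<Longrightarrow> \<exists>y\<in>F. x - y \<in> I" using ideal_finite[OF A I] by blast
  define \<rho> where "\<rho> x = (SOME y. y \<in> F \<and> x - y \<in> I)" for x
  have \<rho>: "\<rho> x \<in> F \<and> x - \<rho> x \<in> I" if "x \<in> A" for x
  proof -
    have "\<exists>y. y \<in> F \<and> x - y \<in> I" using F(2)[OF that] by blast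
    then show ?thesis unfolding \<rho>_def by (rule someI_ex)
  qed
  define v where "v f = (orientation_preserving f, \<lambda>i j. \<rho> (isom_matrix f $ i $ j))" for f
  have "v ` \<Gamma> \<subseteq> UNIV \<times> (UNIV \<rightarrow>\<^sub>E (UNIV \<rightarrow>\<^sub>E F))"
    using \<rho> entries by (auto simp: v_def)
  moreover have "finite (UNIV \<times> (UNIV \<rightarrow>\<^sub>E (UNIV \<rightarrow>\<^sub>E F)) :: (bool \<times> (3 \<Rightarrow> 3 \<Rightarrow> real)) set)"
    using F(1) by (intro finite_SigmaI finite_PiE) auto
  ultimately have "finite (v ` \<Gamma>)" by (rule finite_subset)
  moreover have "?N #>\<^bsub>?G\<^esub> a = ?N #>\<^bsub>?G\<^esub> b" if a: "a \<in> \<Gamma>" and b: "b \<in> \<Gamma>" and eq: "v a = v b" for a b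
  proof -
    let ?b = "inv\<^bsub>isom_group\<^esub> b"
    let ?c = "a \<otimes>\<^bsub>isom_group\<^esub> ?b"
    have b': "?b \<in> \<Gamma>" by (rule subgroup.m_inv_closed[OF \<Gamma> b])
    have c: "?c \<in> \<Gamma>" by (rule subgroup.m_closed[OF \<Gamma> a b'])
    have "matrix_cong I (isom_matrix a) (isom_matrix b)"
      unfolding matrix_cong_def
    proof (intro allI)
      fix i j
      let ?s = "isom_matrix a $ i $ j" and ?t = "isom_matrix b $ i $ j"
      have "\<rho> ?s = \<rho> ?t" using eq by (auto simp: v_def dest: fun_cong)
      moreover have "(?s - \<rho> ?s) - (?t - \<rho> ?t) \<in> I"
        using ideal_diff[OF A I] \<rho>[OF entries[OF a]] \<rho>[OF entries[OF b]] by blast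
      ultimately show "?s - ?t \<in> I" by simp
    qed
    moreover have "isom_matrix b ** isom_matrix ?b = mat 1"
      using isom_matrix_mult[OF iso[OF b] iso[OF b']] isom.r_inv[of b] iso[OF b]
      by (simp add: isom_matrix_one)
    ultimately have "matrix_cong I (isom_matrix ?c) (mat 1)"
      using matrix_cong_mult_right[OF A I _ entries[OF b'], of "isom_matrix a" "isom_matrix b"]
        isom_matrix_mult[OF iso[OF a] iso[OF b']] by simp
    moreover have "\<exists>s. orientation_sign s a \<and> orientation_sign s b \<and> s * s = 1"
    proof (cases "orientation_preserving a")
      case True
      then have "orientation_preserving b" using eq by (simp add: v_def)
      then show ?thesis using True by (intro exI[of _ 1]) (simp add: orientation_preserving_sign)
    next
      case False
      then have "\<not> orientation_preserving b" using eq by (simp add: v_def)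
      then show ?thesis using False orient[OF a] orient[OF b]
        by (intro exI[of _ "-1"]) (simp add: orientation_reversing_sign)
    qed
    then have "orientation_sign 1 ?c"
      using orientation_sign_mult[OF iso[OF a] iso[OF b'] _ orientation_sign_inv[OF iso[OF b]]] by fastforce
    ultimately have "?c \<in> ?N" using c by (simp add: congruence_subgroup_def orientation_preserving_sign)
    moreover have "?c \<otimes>\<^bsub>?G\<^esub> b = a"
      using iso[OF a] iso[OF b] iso[OF b'] by (simp add: isom.m_assoc)
    ultimately have "a \<in> ?N #>\<^bsub>?G\<^esub> b" unfolding r_coset_def by force
    then show ?thesis using G.repr_independence[of a ?N b] b N by simp
  qed
  ultimately have "finite ((\<lambda>a. ?N #>\<^bsub>?G\<^esub> a) ` \<Gamma>)" by (rule finite_image_factor)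
  moreover have "rcosets\<^bsub>?G\<^esub> ?N = (\<lambda>a. ?N #>\<^bsub>?G\<^esub> a) ` \<Gamma>" by (auto simp: RCOSETS_def)
  ultimately show ?thesis by simp
qed

end

section \<open>Excluding torsion\<close>

lemma isom_nat_pow_apply:
  assumes f: "f \<in> hyp_isometries" and z: "z \<in> upper_half_plane"
  shows "(f [^]\<^bsub>isom_group\<^esub> (n::nat)) z = (f ^^ n) z"
  using z
proof (induction n arbitrary: z)
  case 0
  then show ?case by (simp add: isom_one_apply)
next
  case (Suc n)
  have "(f [^]\<^bsub>isom_group\<^esub> Suc n) z = (f [^]\<^bsub>isom_group\<^esub> n) (f z)"
    using Suc.prems f isom.nat_pow_closed[of f n] by (simp add: isom_mult_apply)
  then show ?case using Suc.IH[OF isometry_closed[OF f Suc.prems]] by (simp add: funpow_swap1)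
qed

text \<open>Choose h that brings the fixed point w within C of i. The conjugate by h fixes h w, so
  it moves i by at most twice the distance from i to h w.\<close>

lemma NEC_conjugate_small_displacement:
  assumes C: "\<And>z. z \<in> upper_half_plane \<Longrightarrow> \<exists>h\<in>\<Gamma>. hdist (h z) \<i> \<le> C"
    and \<Gamma>: "\<Gamma> \<subseteq> hyp_isometries" and f: "f \<in> hyp_isometries"
    and w: "w \<in> upper_half_plane" "f w = w"
  shows "\<exists>h\<in>\<Gamma>. hdist ((h \<otimes>\<^bsub>isom_group\<^esub> f \<otimes>\<^bsub>isom_group\<^esub> inv\<^bsub>isom_group\<^esub> h) \<i>) \<i> \<le> 2 * C"
proof -
  obtain h where h: "h \<in> \<Gamma>" "hdist (h w) \<i> \<le> C" using C[OF w(1)] by blast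
  have hi: "h \<in> hyp_isometries" using h \<Gamma> by blast
  define y where "y = h \<otimes>\<^bsub>isom_group\<^esub> f \<otimes>\<^bsub>isom_group\<^esub> inv\<^bsub>isom_group\<^esub> h"
  have closed: "h \<otimes>\<^bsub>isom_group\<^esub> f \<in> hyp_isometries" "inv\<^bsub>isom_group\<^esub> h \<in> hyp_isometries"
    "y \<in> hyp_isometries"
    using isom.m_closed isom.inv_closed hi f unfolding y_def by simp_all
  have hw: "h w \<in> upper_half_plane" by (rule isometry_closed[OF hi w(1)])
  have "y (h w) = h w"
    using w by (simp add: y_def isom_mult_apply closed hi f hw isom_inv_apply isometry_closed)
  have "hdist (y \<i>) \<i> \<le> hdist (y \<i>) (y (h w)) + hdist (y (h w)) \<i>"
    by (intro hyp.triangle isometry_closed[OF closed(3)] hw) simp_all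
  also have "\<dots> = hdist (h w) \<i> + hdist (h w) \<i>"
    using isometry_hdist[OF closed(3) i_in_upper_half_plane hw] \<open>y (h w) = h w\<close> hyp.commute[of \<i> "h w"] by simp
  finally show ?thesis using h unfolding y_def by (intro bexI[of _ h]) auto
qed

theorem theorem3p1:
  fixes \<Gamma> :: "(complex \<Rightarrow> complex) set"
    and g :: nat and \<epsilon> :: nec_sign and ms :: "nat list" and nss :: "nat list list"
  assumes "proper_NEC_group \<Gamma>"
    and "has_signature \<Gamma> g \<epsilon> ms nss"
  shows "\<exists>N. N \<lhd> isom_subgroup \<Gamma> \<and>
    torsion_free (isom_subgroup N) \<and>
    finite (rcosets\<^bsub>isom_subgroup \<Gamma>\<^esub> N) \<and>
    (\<forall>f\<in>N. orientation_preserving f)"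
proof -
  have NEC: "NEC_group \<Gamma>" using assms(1) by (simp add: proper_NEC_group_def)
  then have \<Gamma>: "subgroup \<Gamma> isom_group" by (simp add: NEC_group_def)
  have iso: "f \<in> hyp_isometries" if "f \<in> \<Gamma>" for f by (rule NEC_group_isometry[OF NEC that])
  obtain C where C: "\<And>z. z \<in> upper_half_plane \<Longrightarrow> \<exists>h\<in>\<Gamma>. hdist (h z) \<i> \<le> C"
    using NEC_group_cocompact[OF NEC] by blast
  define T where "T = {f \<in> \<Gamma>. hdist (f \<i>) \<i> \<le> 2 * C}"
  \<comment> \<open>Vanishing entries are discarded because 0 lies in every ideal. If I is disjoint
    from D, an element of T that is congruent to 1 has the identity as its matrix.\<close>
  define D where "D = (\<lambda>(f, i, j). isom_matrix f $ i $ j - mat 1 $ i $ j) ` (T \<times> UNIV) - {0}"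
  have "finite T" unfolding T_def by (rule NEC_group_finite_displacement[OF NEC])
  then have "finite D" "0 \<notin> D" unfolding D_def by auto
  moreover obtain E where E: "finite E"
    "\<And>A. subring_set A \<Longrightarrow> E \<subseteq> A \<Longrightarrow> \<forall>f\<in>\<Gamma>. \<forall>i j. isom_matrix f $ i $ j \<in> A"
    using signature_finitely_generated_entries[OF \<Gamma> assms(2)] by blast
  ultimately obtain A I where A: "subring_set A" and I: "finite_quotient A I"
    and EA: "E \<subseteq> A" and avoid: "I \<inter> D = {}"
    using finite_quotient_avoiding[of E D] by blast
  have entries: "isom_matrix f $ i $ j \<in> A" if "f \<in> \<Gamma>" for f i j
    using E(2)[OF A EA] that by blast
  have orient: "orientation_preserving f \<or> orientation_reversing f" if "f \<in> \<Gamma>" for f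
    by (rule signature_orientation[OF \<Gamma> assms(2) that])
  let ?N = "congruence_subgroup \<Gamma> I"
  have normal: "?N \<lhd> isom_subgroup \<Gamma>"
    by (rule normal_congruence_subgroup[OF A I \<Gamma> entries orient])
  have "x = \<one>\<^bsub>isom_group\<^esub>"
    if x: "x \<in> ?N" and n: "n > 0" and pow: "x [^]\<^bsub>isom_subgroup ?N\<^esub> n = \<one>\<^bsub>isom_group\<^esub>" for x and n :: nat
  proof -
    have x\<Gamma>: "x \<in> \<Gamma>" using x by (simp add: congruence_subgroup_def)
    note xi = iso[OF x\<Gamma>]
    have "x [^]\<^bsub>isom_group\<^esub> n = \<one>\<^bsub>isom_group\<^esub>"
      using pow by (simp add: nat_pow_def)
    then have "(x ^^ n) z = z" if "Im z > 0" for z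
      using isom_nat_pow_apply[OF xi, of z n] that by (simp add: isom_one_apply upper_half_plane_def)
    then obtain w where w: "w \<in> upper_half_plane" "x w = w"
      using finite_order_fixed_point[OF xi n] by (auto simp: upper_half_plane_def)
    obtain h where h: "h \<in> \<Gamma>"
      and disp: "hdist ((h \<otimes>\<^bsub>isom_group\<^esub> x \<otimes>\<^bsub>isom_group\<^esub> inv\<^bsub>isom_group\<^esub> h) \<i>) \<i> \<le> 2 * C"
      using NEC_conjugate_small_displacement[OF C _ xi w] iso by blast
    define y where "y = h \<otimes>\<^bsub>isom_group\<^esub> x \<otimes>\<^bsub>isom_group\<^esub> inv\<^bsub>isom_group\<^esub> h"
    \<comment> \<open>Normality carries membership from x to its conjugate y, which the displacement
      bound places in the finite set T.\<close>
    have yN: "y \<in> ?N"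
      using normal.inv_op_closed2[OF normal, of h x] h x isom.m_inv_consistent[OF \<Gamma> h] by (simp add: y_def)
    then have y: "y \<in> \<Gamma>" "y \<in> T" "matrix_cong I (isom_matrix y) (mat 1)"
      using disp by (auto simp: congruence_subgroup_def T_def y_def)
    have "isom_matrix y $ i $ j - mat 1 $ i $ j = 0" for i j
    proof (rule ccontr)
      assume nz: "isom_matrix y $ i $ j - mat 1 $ i $ j \<noteq> 0"
      have "isom_matrix y $ i $ j - mat 1 $ i $ j \<in> D"
        unfolding D_def using y(2) nz by (intro DiffI image_eqI[of _ _ "(y, i, j)"]) auto
      then show False using y(3) avoid unfolding matrix_cong_def by blast
    qed
    then have "isom_matrix y = mat 1" by (simp add: vec_eq_iff)
    then have "y = \<one>\<^bsub>isom_group\<^esub>"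
      using isom_matrix_eq_mat_1[OF iso[OF y(1)]] isom.one_closed iso[OF y(1)]
      by (intro isometry_eqI) (auto simp: isom_one_apply upper_half_plane_def)
    then show ?thesis
      using isom.inv_solve_right'[of "\<one>\<^bsub>isom_group\<^esub>" "h \<otimes>\<^bsub>isom_group\<^esub> x" h] xi iso[OF h]
        isom.m_closed[of h x] isom.one_closed
      by (simp add: y_def)
  qed
  then have "torsion_free (isom_subgroup ?N)" by (simp add: torsion_free_def)
  moreover have "\<forall>f\<in>?N. orientation_preserving f" by (simp add: congruence_subgroup_def)
  ultimately show ?thesis
    using normal finite_rcosets_congruence_subgroup[OF A I \<Gamma> entries orient] by blast
qed

end
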